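(* Let $\mathbf{u}\in C^1([0,T);V^m)$, $m\ge1$, be a strong solution of the Euler equations on the lattice $\mathbb{\Lambda}^d$. If $d=3$, the energy $E(t)=\tfrac12(\mathbf{u},\mathbf{u})$ and the helicity $H(t)=(\mathbf{u},\boldsymbol\omega)$ are constant in $t\in[0,T)$. If $d=2$, the energy $E(t)=\tfrac12(\mathbf{u},\mathbf{u})$ and the enstrophy $\Omega(t)=\tfrac12(\boldsymbol\omega,\boldsymbol\omega)$ are constant in $t\in[0,T)$.
   Context: Let $\lambda$ be one of: $2$; the plastic number $\sigma$ (unique real root of $x^3-x-1=0$); or $\lambda>1$ with $\lambda^b-\lambda^a=1$ for mutually prime integers $0\le a<b\le62$, $(a,b)\notin\{(1,3),(4,5)\}$. Let $\mathbb{\Lambda}=\{0\}\cup\{\pm\lambda^n:n=0,1,2,\dots\}$ and $d\in\{2,3\}$. Fields on $\mathbb{\Lambda}^d$ satisfy $f(-\mathbf{k})=\overline{f(\mathbf{k})}$. Derivatives $(\partial_jf)(\mathbf{k})=ik_jf(\mathbf{k})$, $(\nabla p)(\mathbf{k})=i\mathbf{k}p(\mathbf{k})$, $(\nabla\cdot\mathbf{u})(\mathbf{k})=i\mathbf{k}\cdot\mathbf{u}(\mathbf{k})$; vorticity $\boldsymbol\omega(\mathbf{k})=i\mathbf{k}\times\mathbf{u}(\mathbf{k})$ for $d=3$ and scalar $\omega(\mathbf{k})=i(k_1u_2(\mathbf{k})-k_2u_1(\mathbf{k}))$ for $d=2$. Inner product $(f,g)=\sum_{\mathbf{k}}f(\mathbf{k})\overline{g(\mathbf{k})}$,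 summed over components for vector fields. Product $(f\ast g)(\mathbf{k})=\sum_{\mathbf{p}+\mathbf{q}=\mathbf{k},\,\mathbf{p},\mathbf{q}\in\mathbb{\Lambda}^d}f(\mathbf{p})g(\mathbf{q})$; $(\mathbf{u}\ast\nabla\mathbf{u})_i=\sum_j u_j\ast\partial_ju_i$. For integer $m\ge0$, $\|\mathbf{u}\|_{h^m}^2=\sum_{\mathbf{k}\neq\mathbf{0}}|\mathbf{k}|^{2m}|\mathbf{u}(\mathbf{k})|^2$; $V^m$ is the space of fields with $\mathbf{u}(\mathbf{0})=\mathbf{0}$, $\nabla\cdot\mathbf{u}=0$ and finite $h^m$ norm, normed by $\|\cdot\|_{h^m}$. A strong solution on $[0,T)$ is $\mathbf{u}\in C^1([0,T);V^m)$ together with a scalar field $p(\cdot,t)$ such that $\partial_t\mathbf{u}+\mathbf{u}\ast\nabla\mathbf{u}=-\nabla p$ holds for all $\mathbf{k}\neq\mathbf{0}$ and $t\in[0,T)$. *)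

theory Defs
  imports "HOL-Analysis.Analysis"
begin

definition admissible_lambda :: "real \<Rightarrow> bool" where
  "admissible_lambda lam \<longleftrightarrow>
     lam = 2
   \<or> lam ^ 3 - lam - 1 = 0
   \<or> (lam > 1 \<and> (\<exists>a b :: nat. coprime a b \<and> a < b \<and> b \<le> 62 \<and>
          (a, b) \<notin> {(1, 3), (4, 5)} \<and> lam ^ b - lam ^ a = 1))"

definition lat1 :: "real \<Rightarrow> real set" where
  "lat1 lam = {0} \<union> {lam ^ n | n. True} \<union> {- (lam ^ n) | n. True}"

definition lat :: "real \<Rightarrow> (real ^ 'd) set" where
  "lat lam = {k. \<forall>i. k $ i \<in> lat1 lam}"

text \<open>Scalar fields: maps real^d to complex; vector fields: maps real^d to complex^d.
  Only values on the lattice are relevant.\<close>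

definition real_sfield :: "real \<Rightarrow> ((real ^ 'd) \<Rightarrow> complex) \<Rightarrow> bool" where
  "real_sfield lam f \<longleftrightarrow> (\<forall>k\<in>lat lam. f (- k) = cnj (f k))"

definition real_vfield :: "real \<Rightarrow> ((real ^ 'd) \<Rightarrow> complex ^ 'd) \<Rightarrow> bool" where
  "real_vfield lam u \<longleftrightarrow> (\<forall>k\<in>lat lam. \<forall>i. u (- k) $ i = cnj (u k $ i))"

definition sinner :: "real \<Rightarrow> ((real ^ 'd) \<Rightarrow> complex) \<Rightarrow> ((real ^ 'd) \<Rightarrow> complex) \<Rightarrow> complex" where
  "sinner lam f g = infsum (\<lambda>k. f k * cnj (g k)) (lat lam)"

definition vinner :: "real \<Rightarrow> ((real ^ 'd) \<Rightarrow> complex ^ 'd) \<Rightarrow> ((real ^ 'd) \<Rightarrow> complex ^ 'd) \<Rightarrow> complex" where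
  "vinner lam u v = infsum (\<lambda>k. \<Sum>i\<in>UNIV. u k $ i * cnj (v k $ i)) (lat lam)"

definition lconv :: "real \<Rightarrow> ((real ^ 'd) \<Rightarrow> complex) \<Rightarrow> ((real ^ 'd) \<Rightarrow> complex) \<Rightarrow> (real ^ 'd) \<Rightarrow> complex" where
  "lconv lam f g k = infsum (\<lambda>(p, q). f p * g q) {(p, q). p \<in> lat lam \<and> q \<in> lat lam \<and> p + q = k}"

definition ldiv :: "((real ^ 'd) \<Rightarrow> complex ^ 'd) \<Rightarrow> (real ^ 'd) \<Rightarrow> complex" where
  "ldiv u k = (\<Sum>j\<in>UNIV. \<i> * of_real (k $ j) * u k $ j)"

definition advect :: "real \<Rightarrow> ((real ^ 'd) \<Rightarrow> complex ^ 'd) \<Rightarrow> (real ^ 'd) \<Rightarrow> complex ^ 'd" where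
  "advect lam u k = (\<chi> i. \<Sum>j\<in>UNIV. lconv lam (\<lambda>p. u p $ j) (\<lambda>q. \<i> * of_real (q $ j) * u q $ i) k)"

definition vort3 :: "((real ^ 3) \<Rightarrow> complex ^ 3) \<Rightarrow> (real ^ 3) \<Rightarrow> complex ^ 3" where
  "vort3 u k = (\<chi> i. if i = 1 then \<i> * (of_real (k $ 2) * u k $ 3 - of_real (k $ 3) * u k $ 2)
                 else if i = 2 then \<i> * (of_real (k $ 3) * u k $ 1 - of_real (k $ 1) * u k $ 3)
                 else \<i> * (of_real (k $ 1) * u k $ 2 - of_real (k $ 2) * u k $ 1))"

definition vort2 :: "((real ^ 2) \<Rightarrow> complex ^ 2) \<Rightarrow> (real ^ 2) \<Rightarrow> complex" where
  "vort2 u k = \<i> * (of_real (k $ 1) * u k $ 2 - of_real (k $ 2) * u k $ 1)"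

definition hm_sq :: "real \<Rightarrow> nat \<Rightarrow> ((real ^ 'd) \<Rightarrow> complex ^ 'd) \<Rightarrow> real" where
  "hm_sq lam m u = infsum (\<lambda>k. norm k ^ (2 * m) * (\<Sum>i\<in>UNIV. (cmod (u k $ i))\<^sup>2)) (lat lam - {0})"

definition hm_norm :: "real \<Rightarrow> nat \<Rightarrow> ((real ^ 'd) \<Rightarrow> complex ^ 'd) \<Rightarrow> real" where
  "hm_norm lam m u = sqrt (hm_sq lam m u)"

definition Vm :: "real \<Rightarrow> nat \<Rightarrow> ((real ^ 'd) \<Rightarrow> complex ^ 'd) set" where
  "Vm lam m = {u. real_vfield lam u \<and> u 0 = 0 \<and> (\<forall>k\<in>lat lam. ldiv u k = 0)
                \<and> (\<lambda>k. norm k ^ (2 * m) * (\<Sum>i\<in>UNIV. (cmod (u k $ i))\<^sup>2)) summable_on (lat lam - {0})}"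

definition C1_Vm :: "real \<Rightarrow> nat \<Rightarrow> real \<Rightarrow> (real \<Rightarrow> (real ^ 'd) \<Rightarrow> complex ^ 'd)
                      \<Rightarrow> (real \<Rightarrow> (real ^ 'd) \<Rightarrow> complex ^ 'd) \<Rightarrow> bool" where
  "C1_Vm lam m T u u' \<longleftrightarrow>
     (\<forall>t\<in>{0..<T}. u t \<in> Vm lam m \<and> u' t \<in> Vm lam m)
   \<and> (\<forall>t\<in>{0..<T}. ((\<lambda>s. hm_norm lam m (\<lambda>k. (1 / (s - t)) *\<^sub>R (u s k - u t k) - u' t k))
                       \<longlongrightarrow> 0) (at t within {0..<T}))
   \<and> (\<forall>t\<in>{0..<T}. ((\<lambda>s. hm_norm lam m (\<lambda>k. u' s k - u' t k)) \<longlongrightarrow> 0) (at t within {0..<T}))"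

definition strong_euler_solution :: "real \<Rightarrow> nat \<Rightarrow> real \<Rightarrow> (real \<Rightarrow> (real ^ 'd) \<Rightarrow> complex ^ 'd)
                                     \<Rightarrow> (real \<Rightarrow> (real ^ 'd) \<Rightarrow> complex) \<Rightarrow> bool" where
  "strong_euler_solution lam m T u p \<longleftrightarrow>
     (\<exists>u'. C1_Vm lam m T u u'
       \<and> (\<forall>t\<in>{0..<T}. real_sfield lam (p t))
       \<and> (\<forall>t\<in>{0..<T}. \<forall>k\<in>lat lam - {0}. \<forall>i.
             u' t k $ i + advect lam (u t) k $ i = - (\<i> * of_real (k $ i) * p t k)))"

definition energy :: "real \<Rightarrow> ((real ^ 'd) \<Rightarrow> complex ^ 'd) \<Rightarrow> complex" where
  "energy lam u = vinner lam u u / 2"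

definition helicity :: "real \<Rightarrow> ((real ^ 3) \<Rightarrow> complex ^ 3) \<Rightarrow> complex" where
  "helicity lam u = vinner lam u (vort3 u)"

definition enstrophy :: "real \<Rightarrow> ((real ^ 2) \<Rightarrow> complex ^ 2) \<Rightarrow> complex" where
  "enstrophy lam u = sinner lam (vort2 u) (vort2 u) / 2"

end

theory Submission
  imports Defs
begin

text \<open>In one dimension every triad \<open>p + q = k\<close> without a zero entry has comparable entries, because distinct
  powers of \<open>\<lambda> > 1\<close> differ by a fixed proportion. So each entry lies in boundedly many such triads, the triad form
  \<open>\<Sum> f(p) g(q) h(p + q)\<close> is bounded on \<open>l\<^sup>2\<close>, and the bound tensorises over coordinates. All sums in the energy
  and helicity balances therefore converge absolutely and cancel under the exchanges \<open>(p, q) \<mapsto> (p, - p - q)\<close> and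
  \<open>(p, q) \<mapsto> (q, p)\<close>. In the enstrophy balance only the triads with different maximum norms of \<open>q\<close> and \<open>p + q\<close>
  converge absolutely; the others cancel within the finite shells of constant maximum norm.\<close>

text \<open>Counting derivatives decides which sums converge. For m >= 1 each of the three fields of
  a triad can absorb one factor |k| and stay in l^2. The energy balance carries only the |q| of the
  gradient; helicity adds one factor on p + q, from the vorticity used as test field. Enstrophy
  carries |q|^2 |p + q|, and the second |q| has no field to absorb it unless |q| is bounded by a
  multiple of |p|. That bound can fail in several dimensions, because p may vanish in exactly the
  coordinates where q and p + q are large. For those triads the control comes from the equation
  itself: the sum over each fibre p + q = k converges to minus the vorticity of the time derivative
  times the conjugate vorticity, a product of two l^2 functions of k. The enstrophy balance is
  therefore an iterated sum, and every rearrangement in it has to stay within a family already known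
  to be summable.\<close>

lemma admissible_lambda_gt_1:
  assumes "admissible_lambda lam"
  shows "1 < lam"
proof -
  \<comment> \<open>\<open>admissible_lambda\<close> records the plastic number only as a real root
    of the cubic, so its position has to be derived. The cases below exclude roots in [0, 1], in
    [-1, 0) and below -1.\<close>
  have "1 < lam" if cubic: "lam ^ 3 - lam - 1 = 0"
  proof (rule ccontr)
    assume "\<not> 1 < lam"
    have eq: "lam * lam\<^sup>2 = lam + 1"
      using cubic by (simp add: power2_eq_square power3_eq_cube)
    show False
    proof (cases "0 \<le> lam")
      case True
      with \<open>\<not> 1 < lam\<close> have "lam * lam\<^sup>2 \<le> lam * 1"
        by (intro mult_left_mono power_le_one) auto
      with eq show False by simp
    next
      case False
      show False
      proof (cases "-1 \<le> lam")
        case True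
        have "lam * lam\<^sup>2 \<ge> lam * 1"
          using False True by (intro mult_left_mono_neg) (auto simp: abs_square_le_1)
        moreover have "lam * lam\<^sup>2 < 0"
          using False by (simp add: mult_neg_pos)
        ultimately show False using eq True by simp
      next
        case lt: False
        \<comment> \<open>By the cubic this product equals 1, yet all three of its factors are
          negative when lam < -1.\<close>
        have "(lam + 1) * (lam * (lam - 1)) = lam * lam\<^sup>2 - lam"
          by (simp add: algebra_simps power2_eq_square)
        moreover have "(lam + 1) * (lam * (lam - 1)) < 0"
          using lt by (intro mult_neg_pos mult_neg_neg) auto
        ultimately show False using eq by simp
      qed
    qed
  qed
  then show ?thesis
    using assms unfolding admissible_lambda_def by auto
qed

section \<open>Triads of the one-dimensional lattice\<close>

lemma lat1_uminus [simp]: "- x \<in> lat1 lam \<longleftrightarrow> x \<in> lat1 lam"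
proof -
  have "- x \<in> lat1 lam" if "x \<in> lat1 lam" for x
    using that unfolding lat1_def by auto
  from this[of x] this[of "- x"] show ?thesis by auto
qed

lemma lat1_abs_eq_power:
  assumes "1 < lam" "x \<in> lat1 lam" "x \<noteq> 0"
  obtains n where "\<bar>x\<bar> = lam ^ n"
  using assms unfolding lat1_def by (auto simp: power_abs)

lemma lat1_abs_ge_1:
  assumes "1 < lam" "x \<in> lat1 lam" "x \<noteq> 0"
  shows "1 \<le> \<bar>x\<bar>"
  using assms by (metis lat1_abs_eq_power less_imp_le one_le_power)

text \<open>The constant is 1 / (1 - 1/lam). If |q| and |p + q| are different powers, they differ by
  at least 1 - 1/lam times the larger one, and by at most |p|. If they are equal, then p = -2q
  because p is nonzero. Zero entries must be excluded: p = 0 admits every q.\<close>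

lemma lat1_triad_ratio:
  assumes lam: "1 < lam"
    and mem: "p \<in> lat1 lam" "q \<in> lat1 lam" "p + q \<in> lat1 lam"
    and nz: "p \<noteq> 0" "q \<noteq> 0" "p + q \<noteq> 0"
  shows "\<bar>q\<bar> \<le> lam / (lam - 1) * \<bar>p\<bar>"
proof -
  obtain m n where m: "\<bar>q\<bar> = lam ^ m" and n: "\<bar>p + q\<bar> = lam ^ n"
    using lat1_abs_eq_power[OF lam] mem nz by metis
  have "(lam - 1) * \<bar>q\<bar> \<le> lam * \<bar>p\<bar>"
  proof (cases m n rule: linorder_cases)
    case less
    then have "lam * lam ^ m \<le> lam ^ n"
      using lam by (metis Suc_leI less_imp_le power_Suc power_increasing)
    then have "(lam - 1) * \<bar>q\<bar> \<le> \<bar>p + q\<bar> - \<bar>q\<bar>"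
      by (simp add: m n algebra_simps)
    also have "\<dots> \<le> 1 * \<bar>p\<bar>" by simp
    also have "\<dots> \<le> lam * \<bar>p\<bar>"
      using lam by (intro mult_right_mono) auto
    finally show ?thesis .
  next
    case equal
    then have "\<bar>p\<bar> = 2 * \<bar>q\<bar>"
      using m n nz by auto
    then show ?thesis
      using lam by (simp add: algebra_simps)
  next
    case greater
    then have "lam * lam ^ n \<le> lam ^ m"
      using lam by (metis Suc_leI less_imp_le power_Suc power_increasing)
    then have "(lam - 1) * \<bar>q\<bar> \<le> lam * (\<bar>q\<bar> - \<bar>p + q\<bar>)"
      by (simp add: m n algebra_simps)
    also have "\<dots> \<le> lam * \<bar>p\<bar>"
      using lam by (intro mult_left_mono) auto
    finally show ?thesis .
  qed
  then show ?thesis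
    using lam by (simp add: field_simps)
qed

lemma card_comparable_lat1:
  assumes lam: "1 < lam"
  shows "\<exists>N. \<forall>y \<in> lat1 lam - {0}.
           finite {x \<in> lat1 lam - {0}. \<bar>x\<bar> \<le> R * \<bar>y\<bar> \<and> \<bar>y\<bar> \<le> R * \<bar>x\<bar>} \<and>
           card {x \<in> lat1 lam - {0}. \<bar>x\<bar> \<le> R * \<bar>y\<bar> \<and> \<bar>y\<bar> \<le> R * \<bar>x\<bar>} \<le> N"
proof -
  obtain B where B: "R < lam ^ B"
    using real_arch_pow[OF lam] by blast
  have close: "m \<le> n + B" if "lam ^ m \<le> R * lam ^ n" for m n
  proof -
    have "lam ^ m < lam ^ B * lam ^ n"
      using that B lam by (smt (verit) mult_strict_right_mono zero_less_power)
    then show ?thesis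
      using lam by (simp add: add.commute flip: power_add)
  qed
  have "finite {x \<in> lat1 lam - {0}. \<bar>x\<bar> \<le> R * \<bar>y\<bar> \<and> \<bar>y\<bar> \<le> R * \<bar>x\<bar>} \<and>
    card {x \<in> lat1 lam - {0}. \<bar>x\<bar> \<le> R * \<bar>y\<bar> \<and> \<bar>y\<bar> \<le> R * \<bar>x\<bar>} \<le> 2 * (2 * B + 1)"
    (is "finite ?K \<and> card ?K \<le> _") if y: "y \<in> lat1 lam - {0}" for y
  proof -
    obtain n where n: "\<bar>y\<bar> = lam ^ n"
      using lat1_abs_eq_power[OF lam] y by blast
    \<comment> \<open>The exponents within B of that of y, so two signs give at most 2 * (2 * B + 1)
      elements. Natural subtraction cuts the window off at 0, in accordance with the nonnegative
      exponents of the lattice.\<close>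
    define E where "E = {n - B..n + B}"
    have "card E \<le> 2 * B + 1" "finite E"
      by (auto simp: E_def)
    have sub: "?K \<subseteq> (\<lambda>j. lam ^ j) ` E \<union> (\<lambda>j. - (lam ^ j)) ` E"
    proof
      fix x assume x: "x \<in> ?K"
      then obtain j where j: "\<bar>x\<bar> = lam ^ j"
        using lat1_abs_eq_power[OF lam] by blast
      then have "j \<in> E"
        using x n close[of j n] close[of n j] by (auto simp: E_def)
      moreover have "x = lam ^ j \<or> x = - (lam ^ j)"
        using j by linarith
      ultimately show "x \<in> (\<lambda>j. lam ^ j) ` E \<union> (\<lambda>j. - (lam ^ j)) ` E"
        by blast
    qed
    have "card ((\<lambda>j. lam ^ j) ` E \<union> (\<lambda>j. - (lam ^ j)) ` E) \<le> card E + card E"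
      by (intro order.trans[OF card_Un_le] add_mono card_image_le \<open>finite E\<close>)
    with \<open>card E \<le> 2 * B + 1\<close> sub \<open>finite E\<close> show ?thesis
      by (meson card_mono finite_UnI finite_imageI finite_subset le_trans mult_le_mono2
          add_mono order.trans[OF _ eq_refl[OF mult_2[symmetric]]])
  qed
  then show ?thesis by blast
qed

text \<open>One factor is estimated by its maximum, which is at most its l^2 norm, and
  Cauchy-Schwarz handles the other two. Pulling a function back along a map with fibres of size at
  most N costs sqrt N in l^2, and this happens twice. The index map \<open>a\<close> may have
  arbitrarily large fibres, so the exceptional entry of a triad goes into that slot.\<close>

lemma trilinear_fibre_bound:
  fixes f g h :: "'a \<Rightarrow> real"
  assumes S: "finite S" and X: "finite X"
    and mem: "a ` X \<subseteq> S" "b ` X \<subseteq> S" "c ` X \<subseteq> S"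
    and fib: "\<And>y. y \<in> S \<Longrightarrow> card {x \<in> X. b x = y} \<le> N" "\<And>y. y \<in> S \<Longrightarrow> card {x \<in> X. c x = y} \<le> N"
    and nonneg: "\<And>x. 0 \<le> f x" "\<And>x. 0 \<le> g x" "\<And>x. 0 \<le> h x"
  shows "(\<Sum>x\<in>X. f (a x) * g (b x) * h (c x)) \<le> real N * (L2_set f S * L2_set g S * L2_set h S)"
proof -
  have pull: "L2_set (\<lambda>x. k (e x)) X \<le> sqrt (real N) * L2_set k S"
    if e: "e ` X \<subseteq> S" and card: "\<And>y. y \<in> S \<Longrightarrow> card {x \<in> X. e x = y} \<le> N"
    for k :: "'a \<Rightarrow> real" and e
  proof -
    have "(\<Sum>x\<in>X. (k (e x))\<^sup>2) = (\<Sum>y\<in>S. \<Sum>x | x \<in> X \<and> e x = y. (k (e x))\<^sup>2)"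
      by (rule sum.group[OF X S e, symmetric])
    also have "\<dots> = (\<Sum>y\<in>S. real (card {x \<in> X. e x = y}) * (k y)\<^sup>2)"
      by (intro sum.cong) auto
    also have "\<dots> \<le> (\<Sum>y\<in>S. real N * (k y)\<^sup>2)"
      using card by (intro sum_mono mult_right_mono) auto
    finally have "(\<Sum>x\<in>X. (k (e x))\<^sup>2) \<le> real N * (\<Sum>y\<in>S. (k y)\<^sup>2)"
      by (simp add: sum_distrib_left)
    then show ?thesis
      unfolding L2_set_def by (metis real_sqrt_le_mono real_sqrt_mult)
  qed
  have "(\<Sum>x\<in>X. f (a x) * g (b x) * h (c x)) \<le> (\<Sum>x\<in>X. L2_set f S * (g (b x) * h (c x)))"
  proof (rule sum_mono)
    fix x assume "x \<in> X"
    then have "f (a x) \<le> L2_set f S"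
      using member_le_L2_set[OF S] mem by blast
    then show "f (a x) * g (b x) * h (c x) \<le> L2_set f S * (g (b x) * h (c x))"
      using nonneg by (simp add: mult.assoc mult_right_mono)
  qed
  also have "\<dots> = L2_set f S * (\<Sum>x\<in>X. \<bar>g (b x)\<bar> * \<bar>h (c x)\<bar>)"
    using nonneg by (simp add: sum_distrib_left)
  also have "\<dots> \<le> L2_set f S * (L2_set (\<lambda>x. g (b x)) X * L2_set (\<lambda>x. h (c x)) X)"
    by (intro mult_left_mono L2_set_mult_ineq) auto
  also have "\<dots> \<le> L2_set f S * ((sqrt (real N) * L2_set g S) * (sqrt (real N) * L2_set h S))"
    using mem fib by (intro mult_left_mono mult_mono pull) auto
  also have "\<dots> = real N * (L2_set f S * L2_set g S * L2_set h S)"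
    by simp
  finally show ?thesis .
qed

text \<open>Each family with a prescribed zero entry contributes 1 to the constant, since either
  remaining entry determines the triad; the triads without a zero entry contribute N. The families
  overlap at zero, which is harmless for nonnegative terms. The constraint is written as a kernel
  \<open>of_bool (p + q = r)\<close> because a product of such kernels over the coordinates is again
  the constraint for vectors.\<close>

lemma lat1_trilinear_bound:
  assumes lam: "1 < lam"
  obtains C :: real where "0 \<le> C"
    "\<And>(f :: real \<Rightarrow> real) g h S. \<lbrakk>finite S; S \<subseteq> lat1 lam; \<And>x. 0 \<le> f x; \<And>x. 0 \<le> g x; \<And>x. 0 \<le> h x\<rbrakk> \<Longrightarrow>
      (\<Sum>p\<in>S. \<Sum>q\<in>S. \<Sum>r\<in>S. of_bool (p + q = r) * (f p * g q * h r))
        \<le> C * (L2_set f S * L2_set g S * L2_set h S)"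
proof -
  define R where "R = lam / (lam - 1)"
  obtain N where N: "\<And>y. y \<in> lat1 lam - {0} \<Longrightarrow>
      finite {x \<in> lat1 lam - {0}. \<bar>x\<bar> \<le> R * \<bar>y\<bar> \<and> \<bar>y\<bar> \<le> R * \<bar>x\<bar>} \<and>
      card {x \<in> lat1 lam - {0}. \<bar>x\<bar> \<le> R * \<bar>y\<bar> \<and> \<bar>y\<bar> \<le> R * \<bar>x\<bar>} \<le> N"
    using card_comparable_lat1[OF lam, of R] by blast
  show ?thesis
  proof (rule that[of "real (N + 3)"])
    fix f g h :: "real \<Rightarrow> real" and S
    assume S: "finite S" "S \<subseteq> lat1 lam"
      and nonneg: "\<And>x. 0 \<le> f x" "\<And>x. 0 \<le> g x" "\<And>x. 0 \<le> h x"
    define F where "F = (\<lambda>(p, q, r). f p * g q * h r)"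
    define M where "M = L2_set f S * L2_set g S * L2_set h S"
    have F_nonneg: "0 \<le> F x" for x
      using nonneg by (auto simp: F_def split: prod.split)
    define X where "X = {(p, q, r). p \<in> S \<and> q \<in> S \<and> r \<in> S \<and> p + q = r}"
    define X1 where "X1 = {(p, q, r) \<in> X. p = 0}"
    define X2 where "X2 = {(p, q, r) \<in> X. q = 0}"
    define X3 where "X3 = {(p, q, r) \<in> X. r = 0}"
    define X4 where "X4 = {(p, q, r) \<in> X. p \<noteq> 0 \<and> q \<noteq> 0 \<and> r \<noteq> 0}"
    have "finite X"
      by (rule finite_subset[of _ "S \<times> S \<times> S"]) (auto simp: X_def S)
    then have fin: "finite X1" "finite X2" "finite X3" "finite X4"
      by (auto intro: finite_subset[of _ X] simp: X1_def X2_def X3_def X4_def)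
    have one: "card {x \<in> Y. e x = y} \<le> 1"
      if "inj_on e Y" "finite Y" for Y :: "(real \<times> real \<times> real) set" and e :: "_ \<Rightarrow> real" and y
      using that by (auto simp: card_le_Suc0_iff_eq inj_on_def)
    have "(\<Sum>p\<in>S. \<Sum>q\<in>S. \<Sum>r\<in>S. of_bool (p + q = r) * (f p * g q * h r))
        = (\<Sum>x\<in>S \<times> S \<times> S. case x of (p, q, r) \<Rightarrow> of_bool (p + q = r) * (f p * g q * h r))"
      by (simp add: sum.cartesian_product)
    also have "\<dots> = sum F X"
      using S(1) by (intro sum.mono_neutral_cong_right) (auto simp: X_def F_def)
    also have "X = X1 \<union> X2 \<union> X3 \<union> X4"
      by (auto simp: X1_def X2_def X3_def X4_def)
    also have "sum F (X1 \<union> X2 \<union> X3 \<union> X4) \<le> sum F X1 + sum F X2 + sum F X3 + sum F X4"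
    proof -
      have un: "sum F (A \<union> B) \<le> sum F A + sum F B" if "finite A" "finite B" for A B
        using sum.union_inter[OF that, of F] sum_nonneg[of "A \<inter> B" F] F_nonneg by simp
      show ?thesis
        using un[of "X1 \<union> X2 \<union> X3" X4] un[of "X1 \<union> X2" X3] un[of X1 X2] fin by simp
    qed
    also have "sum F X1 \<le> real 1 * M"
    proof -
      have "sum F X1 = (\<Sum>x\<in>X1. f (fst x) * g (fst (snd x)) * h (snd (snd x)))"
        by (simp add: F_def split_beta)
      also have "\<dots> \<le> real 1 * M"
        unfolding M_def using S(1) fin nonneg
        by (intro trilinear_fibre_bound one) (auto simp: X1_def X_def inj_on_def)
      finally show ?thesis .
    qed
    also have "sum F X2 \<le> real 1 * M"
    proof -
      have "sum F X2 = (\<Sum>x\<in>X2. g (fst (snd x)) * f (fst x) * h (snd (snd x)))"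
        by (simp add: F_def split_beta mult_ac)
      also have "\<dots> \<le> real 1 * (L2_set g S * L2_set f S * L2_set h S)"
        using S(1) fin nonneg
        by (intro trilinear_fibre_bound one) (auto simp: X2_def X_def inj_on_def)
      finally show ?thesis by (simp add: M_def mult_ac)
    qed
    also have "sum F X3 \<le> real 1 * M"
    proof -
      have "sum F X3 = (\<Sum>x\<in>X3. h (snd (snd x)) * f (fst x) * g (fst (snd x)))"
        by (simp add: F_def split_beta mult_ac)
      also have "\<dots> \<le> real 1 * (L2_set h S * L2_set f S * L2_set g S)"
        using S(1) fin nonneg
        by (intro trilinear_fibre_bound one) (auto simp: X3_def X_def inj_on_def)
      finally show ?thesis by (simp add: M_def mult_ac)
    qed
    also have "sum F X4 \<le> real N * M"
    proof -
      have mem4: "p \<in> lat1 lam - {0} \<and> q \<in> lat1 lam - {0} \<and> r \<in> lat1 lam - {0} \<and> p + q = r"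
        if "(p, q, r) \<in> X4" for p q r
        using that S(2) by (auto simp: X4_def X_def)
      have ratio: "\<bar>p\<bar> \<le> R * \<bar>q\<bar> \<and> \<bar>q\<bar> \<le> R * \<bar>p\<bar> \<and> \<bar>q\<bar> \<le> R * \<bar>r\<bar> \<and> \<bar>r\<bar> \<le> R * \<bar>q\<bar>"
        if "(p, q, r) \<in> X4" for p q r
        using mem4[OF that] lat1_triad_ratio[OF lam, of p q] lat1_triad_ratio[OF lam, of q p]
          lat1_triad_ratio[OF lam, of r "- q"] lat1_triad_ratio[OF lam, of "- q" r]
        by (auto simp: R_def add.commute)
      \<comment> \<open>Here \<open>d\<close> and \<open>e\<close> select two comparable entries and
        \<open>k\<close> rebuilds the triad from them, so a fibre of \<open>e\<close> embeds into
        the entries comparable to y.\<close>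
      have near: "card {x \<in> X4. e x = y} \<le> N"
        if inj: "\<And>x. x \<in> X4 \<Longrightarrow> x = k (d x) (e x)"
          and comp: "\<And>x. x \<in> X4 \<Longrightarrow> d x \<in> lat1 lam - {0} \<and> e x \<in> lat1 lam - {0} \<and>
              \<bar>d x\<bar> \<le> R * \<bar>e x\<bar> \<and> \<bar>e x\<bar> \<le> R * \<bar>d x\<bar>"
        for d e :: "real \<times> real \<times> real \<Rightarrow> real" and k y
      proof (cases "{x \<in> X4. e x = y} = {}")
        case False
        then have y: "y \<in> lat1 lam - {0}" using comp by blast
        let ?K = "{x \<in> lat1 lam - {0}. \<bar>x\<bar> \<le> R * \<bar>y\<bar> \<and> \<bar>y\<bar> \<le> R * \<bar>x\<bar>}"
        have "{x \<in> X4. e x = y} \<subseteq> (\<lambda>z. k z y) ` ?K"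
        proof
          fix x assume "x \<in> {x \<in> X4. e x = y}"
          then show "x \<in> (\<lambda>z. k z y) ` ?K"
            using inj[of x] comp[of x] by (intro image_eqI[of _ _ "d x"]) auto
        qed
        then have "card {x \<in> X4. e x = y} \<le> card ?K"
          using N[OF y] by (meson card_image_le card_mono finite_imageI le_trans)
        with N[OF y] show ?thesis by linarith
      qed (simp only: card.empty)
      have "sum F X4 = (\<Sum>x\<in>X4. f (fst x) * g (fst (snd x)) * h (snd (snd x)))"
        by (simp add: F_def split_beta)
      also have "\<dots> \<le> real N * M"
        unfolding M_def
      proof (rule trilinear_fibre_bound[OF S(1) fin(4)])
        show "card {x \<in> X4. fst (snd x) = y} \<le> N" for y
          by (rule near[where d = fst and k = "\<lambda>p q. (p, q, p + q)"])
            (use mem4 ratio in \<open>force+\<close>)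
        show "card {x \<in> X4. snd (snd x) = y} \<le> N" for y
          by (rule near[where d = "\<lambda>x. fst (snd x)" and k = "\<lambda>q r. (r - q, q, r)"])
            (use mem4 ratio in \<open>force+\<close>)
      qed (use nonneg in \<open>auto simp: X4_def X_def\<close>)
      finally show ?thesis .
    qed
    finally show "(\<Sum>p\<in>S. \<Sum>q\<in>S. \<Sum>r\<in>S. of_bool (p + q = r) * (f p * g q * h r))
        \<le> real (N + 3) * (L2_set f S * L2_set g S * L2_set h S)"
      by (simp add: M_def algebra_simps)
  qed simp
qed

section \<open>Tensorisation of trilinear bounds over coordinates\<close>

lemma sum_PiE_insert:
  assumes "i \<notin> I"
  shows "sum F (Pi\<^sub>E (insert i I) T) = (\<Sum>y\<in>T i. \<Sum>\<phi>\<in>Pi\<^sub>E I T. F (\<phi>(i := y)))"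
proof -
  have "sum F (Pi\<^sub>E (insert i I) T) = sum (F \<circ> (\<lambda>(y, \<phi>). \<phi>(i := y))) (T i \<times> Pi\<^sub>E I T)"
    unfolding PiE_insert_eq by (rule sum.reindex[OF inj_combinator[OF assms]])
  also have "\<dots> = (\<Sum>y\<in>T i. \<Sum>\<phi>\<in>Pi\<^sub>E I T. F (\<phi>(i := y)))"
    by (simp add: sum.cartesian_product split_beta)
  finally show ?thesis .
qed

lemma L2_set_PiE_insert:
  assumes "i \<notin> I"
  shows "L2_set F (Pi\<^sub>E (insert i I) T) = L2_set (\<lambda>y. L2_set (\<lambda>\<phi>. F (\<phi>(i := y))) (Pi\<^sub>E I T)) (T i)"
  by (simp add: L2_set_def sum_PiE_insert[OF assms] sum_nonneg)

text \<open>With the values x, y, z of the new coordinate frozen, the induction hypothesis bounds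
  the inner sums by partial l^2 norms, and nonnegativity of \<kappa> lets this bound pass under the
  kernel. The one-coordinate bound then applies to the partial norms as functions of x, y, z, and
  nested l^2 norms make up the full one. Each coordinate thus costs one factor C.\<close>

lemma PiE_trilinear_bound:
  fixes \<kappa> :: "'a \<Rightarrow> 'a \<Rightarrow> 'a \<Rightarrow> real" and f g h :: "('i \<Rightarrow> 'a) \<Rightarrow> real"
  assumes \<kappa>: "\<And>x y z. 0 \<le> \<kappa> x y z" and C: "0 \<le> C"
    and bound: "\<And>(f :: 'a \<Rightarrow> real) g h. \<lbrakk>\<And>x. 0 \<le> f x; \<And>x. 0 \<le> g x; \<And>x. 0 \<le> h x\<rbrakk> \<Longrightarrow>
      (\<Sum>x\<in>S. \<Sum>y\<in>S. \<Sum>z\<in>S. \<kappa> x y z * (f x * g y * h z)) \<le> C * (L2_set f S * L2_set g S * L2_set h S)"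
    and I: "finite I"
    and nonneg: "\<And>\<phi>. 0 \<le> f \<phi>" "\<And>\<phi>. 0 \<le> g \<phi>" "\<And>\<phi>. 0 \<le> h \<phi>"
  shows "(\<Sum>p\<in>Pi\<^sub>E I (\<lambda>_. S). \<Sum>q\<in>Pi\<^sub>E I (\<lambda>_. S). \<Sum>r\<in>Pi\<^sub>E I (\<lambda>_. S).
            (\<Prod>i\<in>I. \<kappa> (p i) (q i) (r i)) * (f p * g q * h r))
         \<le> C ^ card I * (L2_set f (Pi\<^sub>E I (\<lambda>_. S)) * L2_set g (Pi\<^sub>E I (\<lambda>_. S)) * L2_set h (Pi\<^sub>E I (\<lambda>_. S)))"
  using I nonneg
proof (induction I arbitrary: f g h rule: finite_induct)
  case empty
  then show ?case by simp
next
  case (insert i I)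
  define E where "E = Pi\<^sub>E I (\<lambda>_. S)"
  define W where "W = (\<lambda>p q r. \<Prod>j\<in>I. \<kappa> (p j) (q j) (r j))"
  define A where "A = (\<lambda>x p y q z r. \<kappa> x y z * (W p q r * (f (p(i := x)) * g (q(i := y)) * h (r(i := z)))))"
  have W_upd: "(\<Prod>j\<in>insert i I. \<kappa> ((p(i := x)) j) ((q(i := y)) j) ((r(i := z)) j)) = \<kappa> x y z * W p q r"
    for p q r x y z
    using insert.hyps unfolding W_def
    by (auto simp: prod.insert intro!: arg_cong2[where f = "(*)"] prod.cong)
  have "(\<Sum>p\<in>Pi\<^sub>E (insert i I) (\<lambda>_. S). \<Sum>q\<in>Pi\<^sub>E (insert i I) (\<lambda>_. S). \<Sum>r\<in>Pi\<^sub>E (insert i I) (\<lambda>_. S).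
            (\<Prod>j\<in>insert i I. \<kappa> (p j) (q j) (r j)) * (f p * g q * h r))
      = (\<Sum>x\<in>S. \<Sum>p\<in>E. \<Sum>y\<in>S. \<Sum>q\<in>E. \<Sum>z\<in>S. \<Sum>r\<in>E. A x p y q z r)"
    unfolding sum_PiE_insert[OF insert.hyps(2)] W_upd by (simp only: A_def E_def mult.assoc)
  also have "\<dots> = (\<Sum>x\<in>S. \<Sum>p\<in>E. \<Sum>y\<in>S. \<Sum>z\<in>S. \<Sum>q\<in>E. \<Sum>r\<in>E. A x p y q z r)"
    by (intro sum.cong refl sum.swap)
  also have "\<dots> = (\<Sum>x\<in>S. \<Sum>y\<in>S. \<Sum>p\<in>E. \<Sum>z\<in>S. \<Sum>q\<in>E. \<Sum>r\<in>E. A x p y q z r)"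
    by (rule sum.cong[OF refl], rule sum.swap)
  also have "\<dots> = (\<Sum>x\<in>S. \<Sum>y\<in>S. \<Sum>z\<in>S. \<Sum>p\<in>E. \<Sum>q\<in>E. \<Sum>r\<in>E. A x p y q z r)"
    by (rule sum.cong[OF refl], rule sum.cong[OF refl], rule sum.swap)
  also have "\<dots> \<le> (\<Sum>x\<in>S. \<Sum>y\<in>S. \<Sum>z\<in>S. \<kappa> x y z * (C ^ card I *
      (L2_set (\<lambda>p. f (p(i := x))) E * L2_set (\<lambda>q. g (q(i := y))) E * L2_set (\<lambda>r. h (r(i := z))) E)))"
  proof (intro sum_mono)
    fix x y z
    have "(\<Sum>p\<in>E. \<Sum>q\<in>E. \<Sum>r\<in>E. A x p y q z r)
      = \<kappa> x y z * (\<Sum>p\<in>E. \<Sum>q\<in>E. \<Sum>r\<in>E. W p q r * (f (p(i := x)) * g (q(i := y)) * h (r(i := z))))"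
      by (simp only: A_def sum_distrib_left)
    also have "\<dots> \<le> \<kappa> x y z * (C ^ card I *
      (L2_set (\<lambda>p. f (p(i := x))) E * L2_set (\<lambda>q. g (q(i := y))) E * L2_set (\<lambda>r. h (r(i := z))) E))"
      unfolding W_def E_def by (intro mult_left_mono insert.IH insert.prems \<kappa>)
    finally show "(\<Sum>p\<in>E. \<Sum>q\<in>E. \<Sum>r\<in>E. A x p y q z r) \<le> \<dots>" .
  qed
  also have "\<dots> = C ^ card I * (\<Sum>x\<in>S. \<Sum>y\<in>S. \<Sum>z\<in>S. \<kappa> x y z *
      (L2_set (\<lambda>p. f (p(i := x))) E * L2_set (\<lambda>q. g (q(i := y))) E * L2_set (\<lambda>r. h (r(i := z))) E))"
    by (simp only: sum_distrib_left mult.left_commute)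
  also have "\<dots> \<le> C ^ card I * (C * (L2_set (\<lambda>x. L2_set (\<lambda>p. f (p(i := x))) E) S *
      L2_set (\<lambda>y. L2_set (\<lambda>q. g (q(i := y))) E) S * L2_set (\<lambda>z. L2_set (\<lambda>r. h (r(i := z))) E) S))"
    using C by (intro mult_left_mono bound) auto
  also have "\<dots> = C ^ card (insert i I) * (L2_set f (Pi\<^sub>E (insert i I) (\<lambda>_. S)) *
      L2_set g (Pi\<^sub>E (insert i I) (\<lambda>_. S)) * L2_set h (Pi\<^sub>E (insert i I) (\<lambda>_. S)))"
    using insert.hyps by (simp add: E_def L2_set_PiE_insert)
  finally show ?case .
qed

section \<open>Absolute convergence over triads of the lattice\<close>

abbreviation square_summable_on :: "('a \<Rightarrow> 'b::real_normed_vector) \<Rightarrow> 'a set \<Rightarrow> bool"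
    (infix "square'_summable'_on" 46) where
  "f square_summable_on A \<equiv> (\<lambda>k. (norm (f k))\<^sup>2) summable_on A"

definition triads :: "real \<Rightarrow> ((real ^ 'd) \<times> (real ^ 'd)) set" where
  "triads lam = {(p, q). p \<in> lat lam \<and> q \<in> lat lam \<and> p + q \<in> lat lam}"

lemma L2_set_box_le:
  fixes f :: "real ^ 'd \<Rightarrow> 'a::real_normed_vector"
  assumes f: "f square_summable_on lat lam" and S: "finite S" "S \<subseteq> lat1 lam"
  shows "L2_set (\<lambda>\<phi>. norm (f (\<chi> i. \<phi> i))) (Pi\<^sub>E UNIV (\<lambda>_. S))
           \<le> sqrt (\<Sum>\<^sub>\<infinity>k\<in>lat lam. (norm (f k))\<^sup>2)"
proof -
  let ?E = "Pi\<^sub>E (UNIV :: 'd set) (\<lambda>_. S)"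
  have "inj_on (\<lambda>\<phi>. \<chi> i. \<phi> i) ?E"
    by (auto simp: inj_on_def vec_eq_iff)
  then have "(\<Sum>\<phi>\<in>?E. (norm (f (\<chi> i. \<phi> i)))\<^sup>2) = (\<Sum>k\<in>(\<lambda>\<phi>. \<chi> i. \<phi> i) ` ?E. (norm (f k))\<^sup>2)"
    by (simp add: sum.reindex)
  also have "\<dots> \<le> (\<Sum>\<^sub>\<infinity>k\<in>lat lam. (norm (f k))\<^sup>2)"
    using S by (intro finite_sum_le_infsum f) (auto simp: lat_def finite_PiE dest!: PiE_mem)
  finally show ?thesis
    unfolding L2_set_def by simp
qed

text \<open>The partial sums over finite sets of triads are bounded uniformly: each such set lies in
  a finite box, and the constant of the tensorised estimate does not depend on the box.\<close>

lemma triads_summable: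
  fixes f :: "real ^ 'd \<Rightarrow> 'a::real_normed_vector" and g :: "real ^ 'd \<Rightarrow> 'b::real_normed_vector"
    and h :: "real ^ 'd \<Rightarrow> 'c::real_normed_vector"
  assumes lam: "1 < lam"
    and "f square_summable_on lat lam" "g square_summable_on lat lam" "h square_summable_on lat lam"
  shows "(\<lambda>(p, q). norm (f p) * norm (g q) * norm (h (p + q))) summable_on triads lam"
proof -
  obtain C :: real where C: "0 \<le> C" and bound:
    "\<And>(f :: real \<Rightarrow> real) g h S. \<lbrakk>finite S; S \<subseteq> lat1 lam; \<And>x. 0 \<le> f x; \<And>x. 0 \<le> g x; \<And>x. 0 \<le> h x\<rbrakk> \<Longrightarrow>
      (\<Sum>p\<in>S. \<Sum>q\<in>S. \<Sum>r\<in>S. of_bool (p + q = r) * (f p * g q * h r))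
        \<le> C * (L2_set f S * L2_set g S * L2_set h S)"
    using lat1_trilinear_bound[OF lam] by blast
  let ?N = "\<lambda>f. sqrt (\<Sum>\<^sub>\<infinity>k\<in>lat lam. (norm (f k))\<^sup>2)"
  show ?thesis
  proof (rule nonneg_bdd_above_summable_on)
    have "(\<Sum>x\<in>F. case x of (p, q) \<Rightarrow> norm (f p) * norm (g q) * norm (h (p + q)))
        \<le> C ^ CARD('d) * (?N f * ?N g * ?N h)"
      if F: "F \<subseteq> triads lam" "finite F" for F
    proof -
      \<comment> \<open>All coordinates that occur in F, pooled over the directions, so that the box
        is a power of one finite set as \<open>PiE_trilinear_bound\<close> requires.\<close>
      define S where "S = (\<Union>(p, q)\<in>F. range (($) p) \<union> range (($) q) \<union> range (($) (p + q)))"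
      have S: "finite S" "S \<subseteq> lat1 lam"
        using F by (auto simp: S_def triads_def lat_def simp del: vector_add_component)
      define E where "E = Pi\<^sub>E (UNIV :: 'd set) (\<lambda>_. S)"
      define J :: "(real ^ 'd) \<times> (real ^ 'd) \<Rightarrow> _" where "J = (\<lambda>(p, q). (($) p, ($) q, ($) (p + q)))"
      define G :: "('d \<Rightarrow> real) \<times> ('d \<Rightarrow> real) \<times> ('d \<Rightarrow> real) \<Rightarrow> real" where
        "G = (\<lambda>(p, q, r). (\<Prod>i\<in>UNIV. of_bool (p i + q i = r i)) *
               (norm (f (\<chi> i. p i)) * norm (g (\<chi> i. q i)) * norm (h (\<chi> i. r i))))"
      have inj: "inj_on J F"
        by (auto simp: inj_on_def J_def vec_eq_iff fun_eq_iff)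
      have GJ: "G (J x) = (case x of (p, q) \<Rightarrow> norm (f p) * norm (g q) * norm (h (p + q)))" for x
        by (auto simp: G_def J_def split: prod.split)
      have "(\<Sum>x\<in>F. case x of (p, q) \<Rightarrow> norm (f p) * norm (g q) * norm (h (p + q))) = sum G (J ` F)"
        by (simp add: sum.reindex[OF inj] GJ)
      also have "\<dots> \<le> sum G (E \<times> E \<times> E)"
      proof (rule sum_mono2)
        show "finite (E \<times> E \<times> E)"
          using S by (simp add: E_def finite_PiE)
        show "J ` F \<subseteq> E \<times> E \<times> E"
          by (force simp: J_def E_def S_def PiE_UNIV_domain)
        show "0 \<le> G b" for b
          by (auto simp: G_def split: prod.split intro!: mult_nonneg_nonneg prod_nonneg)
      qed
      also have "\<dots> = (\<Sum>p\<in>E. \<Sum>q\<in>E. \<Sum>r\<in>E. (\<Prod>i\<in>UNIV. of_bool (p i + q i = r i)) *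
               (norm (f (\<chi> i. p i)) * norm (g (\<chi> i. q i)) * norm (h (\<chi> i. r i))))"
        by (simp add: G_def sum.cartesian_product)
      also have "\<dots> \<le> C ^ CARD('d) * (L2_set (\<lambda>\<phi>. norm (f (\<chi> i. \<phi> i))) E *
          L2_set (\<lambda>\<phi>. norm (g (\<chi> i. \<phi> i))) E * L2_set (\<lambda>\<phi>. norm (h (\<chi> i. \<phi> i))) E)"
        unfolding E_def
        by (rule PiE_trilinear_bound) (use bound[OF S] C in auto)
      also have "\<dots> \<le> C ^ CARD('d) * (?N f * ?N g * ?N h)"
        unfolding E_def using assms S C
        by (intro mult_left_mono mult_mono L2_set_box_le) (auto intro!: infsum_nonneg mult_nonneg_nonneg)
      finally show ?thesis .
    qed
    then show "bdd_above (sum (\<lambda>(p, q). norm (f p) * norm (g q) * norm (h (p + q))) `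
        {F. F \<subseteq> triads lam \<and> finite F})"
      by (intro bdd_aboveI2) blast
  qed auto
qed

lemma Cauchy_Schwarz_infsum:
  fixes f :: "'k \<Rightarrow> 'a::real_normed_vector" and g :: "'k \<Rightarrow> 'b::real_normed_vector"
  assumes f: "f square_summable_on A" and g: "g square_summable_on A"
  shows "(\<lambda>k. norm (f k) * norm (g k)) summable_on A"
    and "(\<Sum>\<^sub>\<infinity>k\<in>A. norm (f k) * norm (g k))
           \<le> sqrt (\<Sum>\<^sub>\<infinity>k\<in>A. (norm (f k))\<^sup>2) * sqrt (\<Sum>\<^sub>\<infinity>k\<in>A. (norm (g k))\<^sup>2)"
proof -
  show summable: "(\<lambda>k. norm (f k) * norm (g k)) summable_on A"
  proof (rule summable_on_comparison_test[OF summable_on_add[OF f g]])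
    show "norm (f k) * norm (g k) \<le> (norm (f k))\<^sup>2 + (norm (g k))\<^sup>2" for k
      using sum_squares_bound[of "norm (f k)" "norm (g k)"]
        mult_nonneg_nonneg[OF norm_ge_zero[of "f k"] norm_ge_zero[of "g k"]] by linarith
  qed auto
  show "(\<Sum>\<^sub>\<infinity>k\<in>A. norm (f k) * norm (g k))
           \<le> sqrt (\<Sum>\<^sub>\<infinity>k\<in>A. (norm (f k))\<^sup>2) * sqrt (\<Sum>\<^sub>\<infinity>k\<in>A. (norm (g k))\<^sup>2)"
  proof (rule infsum_le_finite_sums[OF summable])
    fix F assume F: "finite F" "F \<subseteq> A"
    have "(\<Sum>k\<in>F. norm (f k) * norm (g k)) \<le> L2_set (\<lambda>k. norm (f k)) F * L2_set (\<lambda>k. norm (g k)) F"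
      using L2_set_mult_ineq[of "\<lambda>k. norm (f k)" "\<lambda>k. norm (g k)" F] by simp
    also have "\<dots> \<le> sqrt (\<Sum>\<^sub>\<infinity>k\<in>A. (norm (f k))\<^sup>2) * sqrt (\<Sum>\<^sub>\<infinity>k\<in>A. (norm (g k))\<^sup>2)"
      unfolding L2_set_def using F f g
      by (intro mult_mono real_sqrt_le_mono finite_sum_le_infsum) (auto intro!: infsum_nonneg sum_nonneg)
    finally show "(\<Sum>k\<in>F. norm (f k) * norm (g k)) \<le> \<dots>" .
  qed
qed

section \<open>Time derivatives of quadratic forms\<close>

text \<open>Giving sqrt w to each argument turns the weighted estimate into the plain Cauchy-Schwarz
  inequality.\<close>

lemma summable_on_weighted_bilinear:
  fixes b :: "'k \<Rightarrow> 'a::real_normed_vector \<Rightarrow> 'b::real_normed_vector \<Rightarrow> 'c::banach"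
  assumes w: "\<And>k. k \<in> X \<Longrightarrow> 0 \<le> w k"
    and bound: "\<And>k x y. k \<in> X \<Longrightarrow> norm (b k x y) \<le> c * (w k * (norm x * norm y))" and c: "0 \<le> c"
    and v: "(\<lambda>k. w k * (norm (v k))\<^sup>2) summable_on X" and z: "(\<lambda>k. w k * (norm (z k))\<^sup>2) summable_on X"
  shows "(\<lambda>k. b k (v k) (z k)) summable_on X"
    and "norm (\<Sum>\<^sub>\<infinity>k\<in>X. b k (v k) (z k))
          \<le> c * (sqrt (\<Sum>\<^sub>\<infinity>k\<in>X. w k * (norm (v k))\<^sup>2) * sqrt (\<Sum>\<^sub>\<infinity>k\<in>X. w k * (norm (z k))\<^sup>2))"
proof -
  define v' where "v' k = sqrt (w k) *\<^sub>R v k" for k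
  define z' where "z' k = sqrt (w k) *\<^sub>R z k" for k
  have v': "(norm (v' k))\<^sup>2 = w k * (norm (v k))\<^sup>2" and z': "(norm (z' k))\<^sup>2 = w k * (norm (z k))\<^sup>2"
    if "k \<in> X" for k
    using w[OF that] by (auto simp: v'_def z'_def power_mult_distrib)
  have le: "norm (b k (v k) (z k)) \<le> c * (norm (v' k) * norm (z' k))" if "k \<in> X" for k
  proof -
    have "norm (v' k) * norm (z' k) = (sqrt (w k) * sqrt (w k)) * (norm (v k) * norm (z k))"
      using w[OF that] by (simp only: v'_def z'_def norm_scaleR abs_of_nonneg real_sqrt_ge_zero mult_ac)
    then show ?thesis
      using bound[OF that, of "v k" "z k"] w[OF that] by simp
  qed
  have v'_sum: "v' square_summable_on X" and z'_sum: "z' square_summable_on X"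
    using v z by (auto simp: v' z' cong: summable_on_cong)
  note CS = Cauchy_Schwarz_infsum[OF v'_sum z'_sum]
  have abs: "(\<lambda>k. norm (b k (v k) (z k))) summable_on X"
    by (rule summable_on_comparison_test[OF summable_on_cmult_right[OF CS(1), of c]]) (use le in auto)
  then show "(\<lambda>k. b k (v k) (z k)) summable_on X"
    by (rule abs_summable_summable)
  have "norm (\<Sum>\<^sub>\<infinity>k\<in>X. b k (v k) (z k)) \<le> (\<Sum>\<^sub>\<infinity>k\<in>X. norm (b k (v k) (z k)))"
    by (rule norm_infsum_bound[OF abs])
  also have "\<dots> \<le> (\<Sum>\<^sub>\<infinity>k\<in>X. c * (norm (v' k) * norm (z' k)))"
    by (rule infsum_mono[OF abs summable_on_cmult_right[OF CS(1)] le])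
  also have "\<dots> = c * (\<Sum>\<^sub>\<infinity>k\<in>X. norm (v' k) * norm (z' k))"
    by (rule infsum_cmult_right[OF CS(1)])
  also have "\<dots> \<le> c * (sqrt (\<Sum>\<^sub>\<infinity>k\<in>X. (norm (v' k))\<^sup>2) * sqrt (\<Sum>\<^sub>\<infinity>k\<in>X. (norm (z' k))\<^sup>2))"
    by (rule mult_left_mono[OF CS(2) c])
  finally show "norm (\<Sum>\<^sub>\<infinity>k\<in>X. b k (v k) (z k))
      \<le> c * (sqrt (\<Sum>\<^sub>\<infinity>k\<in>X. w k * (norm (v k))\<^sup>2) * sqrt (\<Sum>\<^sub>\<infinity>k\<in>X. w k * (norm (z k))\<^sup>2))"
    by (simp add: v' z' cong: infsum_cong)
qed

lemma norm_add_square_le: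
  fixes x y :: "'a::real_normed_vector"
  shows "(norm (x + y))\<^sup>2 \<le> 2 * (norm x)\<^sup>2 + 2 * (norm y)\<^sup>2"
proof -
  have "(norm (x + y))\<^sup>2 \<le> (norm x + norm y)\<^sup>2"
    by (intro power_mono norm_triangle_ineq) auto
  also have "\<dots> \<le> 2 * (norm x)\<^sup>2 + 2 * (norm y)\<^sup>2"
    using sum_squares_bound[of "norm x" "norm y"] by (simp add: power2_sum)
  finally show ?thesis .
qed

lemma weighted_square_summable_add:
  fixes v z :: "'k \<Rightarrow> 'a::real_normed_vector"
  assumes w: "\<And>k. k \<in> X \<Longrightarrow> 0 \<le> w k"
    and v: "(\<lambda>k. w k * (norm (v k))\<^sup>2) summable_on X" and z: "(\<lambda>k. w k * (norm (z k))\<^sup>2) summable_on X"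
  shows "(\<lambda>k. w k * (norm (v k + z k))\<^sup>2) summable_on X"
    and "(\<Sum>\<^sub>\<infinity>k\<in>X. w k * (norm (v k + z k))\<^sup>2)
          \<le> 2 * (\<Sum>\<^sub>\<infinity>k\<in>X. w k * (norm (v k))\<^sup>2) + 2 * (\<Sum>\<^sub>\<infinity>k\<in>X. w k * (norm (z k))\<^sup>2)"
proof -
  note v2 = summable_on_cmult_right[OF v, of 2] and z2 = summable_on_cmult_right[OF z, of 2]
  have le: "w k * (norm (v k + z k))\<^sup>2 \<le> 2 * (w k * (norm (v k))\<^sup>2) + 2 * (w k * (norm (z k))\<^sup>2)"
    if "k \<in> X" for k
    using mult_left_mono[OF norm_add_square_le[of "v k" "z k"] w[OF that]] by (simp add: algebra_simps)
  show sum: "(\<lambda>k. w k * (norm (v k + z k))\<^sup>2) summable_on X"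
    by (rule summable_on_comparison_test[OF summable_on_add[OF v2 z2] le]) (use w in auto)
  have "(\<Sum>\<^sub>\<infinity>k\<in>X. w k * (norm (v k + z k))\<^sup>2)
      \<le> (\<Sum>\<^sub>\<infinity>k\<in>X. 2 * (w k * (norm (v k))\<^sup>2) + 2 * (w k * (norm (z k))\<^sup>2))"
    by (rule infsum_mono[OF sum summable_on_add[OF v2 z2] le])
  also have "\<dots> = 2 * (\<Sum>\<^sub>\<infinity>k\<in>X. w k * (norm (v k))\<^sup>2) + 2 * (\<Sum>\<^sub>\<infinity>k\<in>X. w k * (norm (z k))\<^sup>2)"
    by (simp only: infsum_add[OF v2 z2] infsum_cmult_right[OF v] infsum_cmult_right[OF z])
  finally show "(\<Sum>\<^sub>\<infinity>k\<in>X. w k * (norm (v k + z k))\<^sup>2) \<le> \<dots>" .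
qed

text \<open>Write u(s) = u(t) + h d with h = s - t and d = e + u'(t), where e is the error of the
  difference quotient. After removing the linear term, the remainder consists of h times cross terms
  with e and of h^2 b(d, d). The weighted norm of e tends to 0 and that of d stays bounded near t,
  so the remainder is o(h). Differentiability is used in the norm throughout, and no sum is
  differentiated term by term.\<close>

lemma quadratic_form_has_vector_derivative:
  fixes b :: "'k \<Rightarrow> 'a::real_normed_vector \<Rightarrow> 'a \<Rightarrow> 'c::banach" and u u' :: "real \<Rightarrow> 'k \<Rightarrow> 'a"
  assumes bil: "\<And>k. k \<in> X \<Longrightarrow> bounded_bilinear (b k)"
    and w: "\<And>k. k \<in> X \<Longrightarrow> 0 \<le> w k"
    and bound: "\<And>k x y. k \<in> X \<Longrightarrow> norm (b k x y) \<le> c * (w k * (norm x * norm y))" and c: "0 \<le> c"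
    and u: "\<And>s. s \<in> I \<Longrightarrow> (\<lambda>k. w k * (norm (u s k))\<^sup>2) summable_on X"
    and u': "(\<lambda>k. w k * (norm (u' t k))\<^sup>2) summable_on X"
    and t: "t \<in> I"
    and deriv: "((\<lambda>s. sqrt (\<Sum>\<^sub>\<infinity>k\<in>X. w k * (norm ((1 / (s - t)) *\<^sub>R (u s k - u t k) - u' t k))\<^sup>2)) \<longlongrightarrow> 0)
                  (at t within I)"
  shows "((\<lambda>s. \<Sum>\<^sub>\<infinity>k\<in>X. b k (u s k) (u s k)) has_vector_derivative
           (\<Sum>\<^sub>\<infinity>k\<in>X. b k (u' t k) (u t k) + b k (u t k) (u' t k))) (at t within I)"
proof -
  define N where "N v = sqrt (\<Sum>\<^sub>\<infinity>k\<in>X. w k * (norm (v k))\<^sup>2)" for v :: "'k \<Rightarrow> 'a"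
  define e where "e s k = (1 / (s - t)) *\<^sub>R (u s k - u t k) - u' t k" for s k
  define f where "f s = (\<Sum>\<^sub>\<infinity>k\<in>X. b k (u s k) (u s k))" for s
  define D where "D = (\<Sum>\<^sub>\<infinity>k\<in>X. b k (u' t k) (u t k) + b k (u t k) (u' t k))"
  have sumb: "(\<lambda>k. b k (v k) (z k)) summable_on X" and normb: "norm (\<Sum>\<^sub>\<infinity>k\<in>X. b k (v k) (z k)) \<le> c * (N v * N z)"
    if "(\<lambda>k. w k * (norm (v k))\<^sup>2) summable_on X" "(\<lambda>k. w k * (norm (z k))\<^sup>2) summable_on X" for v z
    using summable_on_weighted_bilinear[where b = b and c = c, OF w bound c that] by (auto simp: N_def)
  have N_nonneg: "0 \<le> N v" for v
    unfolding N_def using w by (auto intro!: infsum_nonneg)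
  have scale: "(\<lambda>k. w k * (norm (r *\<^sub>R v k))\<^sup>2) summable_on X"
    if "(\<lambda>k. w k * (norm (v k))\<^sup>2) summable_on X" for r v
    using summable_on_cmult_right[OF that, of "r\<^sup>2"] by (simp add: power_mult_distrib mult_ac)
  have main: "norm (f s - f t - (s - t) *\<^sub>R D) / norm (s - t)
      \<le> 2 * c * N (e s) * N (u t) + 2 * c * \<bar>s - t\<bar> * ((N (e s))\<^sup>2 + (N (u' t))\<^sup>2)"
    if s: "s \<in> I" "s \<noteq> t" for s
  proof -
    define h where "h = s - t"
    define d where "d k = e s k + u' t k" for k
    have h: "h \<noteq> 0" using s by (simp add: h_def)
    have us: "u s k = u t k + h *\<^sub>R d k" for k
      using h by (simp add: d_def e_def h_def)
    have "(\<lambda>k. w k * (norm (u s k + (-1) *\<^sub>R u t k))\<^sup>2) summable_on X"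
      by (intro weighted_square_summable_add w scale u s t)
    from weighted_square_summable_add(1)[OF w scale[OF this, of "1 / h"] scale[OF u', of "-1"]]
    have e_sum: "(\<lambda>k. w k * (norm (e s k))\<^sup>2) summable_on X"
      by (simp add: e_def h_def)
    have d_sum: "(\<lambda>k. w k * (norm (d k))\<^sup>2) summable_on X"
      and d_le: "(N d)\<^sup>2 \<le> 2 * (N (e s))\<^sup>2 + 2 * (N (u' t))\<^sup>2"
      using weighted_square_summable_add[OF w e_sum u'] w
      by (auto simp: d_def N_def infsum_nonneg)
    have exp: "b k (u s k) (u s k) = b k (u t k) (u t k) + h *\<^sub>R (b k (u' t k) (u t k) + b k (u t k) (u' t k))
        + h *\<^sub>R (b k (e s k) (u t k) + b k (u t k) (e s k)) + h\<^sup>2 *\<^sub>R b k (d k) (d k)"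
      if "k \<in> X" for k
    proof -
      interpret bounded_bilinear "b k" using bil[OF that] .
      show ?thesis
        unfolding us by (simp add: add_left add_right scaleR_left scaleR_right scaleR_add_right
            power2_eq_square) (simp add: d_def add_left add_right scaleR_add_right)
    qed
    have sum_D: "(\<lambda>k. b k (u' t k) (u t k) + b k (u t k) (u' t k)) summable_on X"
      and sum_e: "(\<lambda>k. b k (e s k) (u t k) + b k (u t k) (e s k)) summable_on X"
      by (intro summable_on_add sumb u u' e_sum t)+
    have "f s = f t + h *\<^sub>R D + h *\<^sub>R (\<Sum>\<^sub>\<infinity>k\<in>X. b k (e s k) (u t k) + b k (u t k) (e s k))
        + h\<^sup>2 *\<^sub>R (\<Sum>\<^sub>\<infinity>k\<in>X. b k (d k) (d k))"
      unfolding f_def D_def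
      by (subst infsum_cong[OF exp], assumption)
        (simp add: infsum_add infsum_scaleR_right summable_on_add summable_on_scaleR_right
          sum_D sum_e sumb u t d_sum del: scaleR_add_right)
    also have "(\<Sum>\<^sub>\<infinity>k\<in>X. b k (e s k) (u t k) + b k (u t k) (e s k))
        = (\<Sum>\<^sub>\<infinity>k\<in>X. b k (e s k) (u t k)) + (\<Sum>\<^sub>\<infinity>k\<in>X. b k (u t k) (e s k))"
      by (intro infsum_add sumb u e_sum t)
    finally have "norm (f s - f t - h *\<^sub>R D) = norm (h *\<^sub>R (\<Sum>\<^sub>\<infinity>k\<in>X. b k (e s k) (u t k))
        + h *\<^sub>R (\<Sum>\<^sub>\<infinity>k\<in>X. b k (u t k) (e s k)) + h\<^sup>2 *\<^sub>R (\<Sum>\<^sub>\<infinity>k\<in>X. b k (d k) (d k)))"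
      by (simp add: scaleR_add_right)
    also have "\<dots> \<le> \<bar>h\<bar> * (c * (N (e s) * N (u t))) + \<bar>h\<bar> * (c * (N (u t) * N (e s))) + h\<^sup>2 * (c * (N d * N d))"
      by (intro norm_triangle_le add_mono)
        (auto intro!: mult_left_mono normb u e_sum d_sum t)
    also have "\<dots> \<le> \<bar>h\<bar> * (2 * c * N (e s) * N (u t)) + h\<^sup>2 * (c * (2 * (N (e s))\<^sup>2 + 2 * (N (u' t))\<^sup>2))"
      using mult_left_mono[OF mult_left_mono[OF d_le c], of "h\<^sup>2"]
      by (simp add: power2_eq_square algebra_simps)
    also have "\<dots> = \<bar>h\<bar> * (2 * c * N (e s) * N (u t) + 2 * c * \<bar>h\<bar> * ((N (e s))\<^sup>2 + (N (u' t))\<^sup>2))"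
      by (simp only: power2_abs[of h, symmetric] power2_eq_square[of "\<bar>h\<bar>"] algebra_simps)
    finally show ?thesis
      using h by (simp add: h_def divide_le_eq mult.commute)
  qed
  have e_lim: "((\<lambda>s. N (e s)) \<longlongrightarrow> 0) (at t within I)"
    using deriv by (simp add: N_def e_def)
  let ?B = "\<lambda>s. 2 * c * N (e s) * N (u t) + 2 * c * \<bar>s - t\<bar> * ((N (e s))\<^sup>2 + (N (u' t))\<^sup>2)"
  have "(?B \<longlongrightarrow> 2 * c * 0 * N (u t) + 2 * c * \<bar>t - t\<bar> * (0\<^sup>2 + (N (u' t))\<^sup>2)) (at t within I)"
    by (intro tendsto_intros e_lim)
  then have B_lim: "(?B \<longlongrightarrow> 0) (at t within I)"
    by simp
  have ev: "\<forall>\<^sub>F s in at t within I. norm (f s - f t - (s - t) *\<^sub>R D) / norm (s - t) \<le> ?B s"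
    unfolding eventually_at_filter by (intro always_eventually allI impI main)
  have "((\<lambda>s. norm (f s - f t - (s - t) *\<^sub>R D) / norm (s - t)) \<longlongrightarrow> 0) (at t within I)"
    by (rule tendsto_sandwich[OF _ ev tendsto_const B_lim]) simp
  then show ?thesis
    unfolding has_vector_derivative_def has_derivative_iff_norm f_def D_def
    by (simp add: bounded_linear_scaleR_left)
qed

section \<open>The gap at zero in the lattice and the spaces V^m\<close>

lemma lat_uminus [simp]: "- k \<in> lat lam \<longleftrightarrow> k \<in> lat lam"
  by (simp add: lat_def)

lemma lat_norm_ge_1:
  fixes k :: "real ^ 'd"
  assumes "1 < lam" "k \<in> lat lam" "k \<noteq> 0"
  shows "1 \<le> norm k"
proof -
  obtain i where "k $ i \<noteq> 0"
    using assms(3) by (auto simp: vec_eq_iff)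
  then have "1 \<le> \<bar>k $ i\<bar>"
    using assms by (intro lat1_abs_ge_1) (auto simp: lat_def)
  also have "\<dots> \<le> norm k"
    by (rule component_le_norm_cart)
  finally show ?thesis .
qed

lemma norm_vec_square: "(\<Sum>i\<in>UNIV. (norm (x $ i))\<^sup>2) = (norm x)\<^sup>2"
  by (simp add: norm_vec_def L2_set_def sum_nonneg)

lemma norm_square_le_weight:
  fixes k :: "real ^ 'd"
  assumes "1 < lam" "k \<in> lat lam - {0}" "1 \<le> m"
  shows "(norm k)\<^sup>2 \<le> norm k ^ (2 * m)"
  using assms by (intro power_increasing lat_norm_ge_1[of lam]) auto

text \<open>Nonzero lattice vectors have length at least 1, so every weight with m >= 1 dominates
  |k|^2, and |k|^2 dominates 1. These two bounds are the form in which the regularity of u enters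
  the triad sums.\<close>

lemma Vm_square_summable:
  fixes u :: "real ^ 'd \<Rightarrow> complex ^ 'd"
  assumes lam: "1 < lam" and m: "1 \<le> m" and u: "u \<in> Vm lam m"
  shows "(\<lambda>k. norm k *\<^sub>R u k) square_summable_on lat lam" and "u square_summable_on lat lam"
proof -
  have w: "(\<lambda>k. norm k ^ (2 * m) * (norm (u k))\<^sup>2) summable_on (lat lam - {0})"
    using u by (simp add: Vm_def norm_vec_square)
  have "(\<lambda>k. (norm (norm k *\<^sub>R u k))\<^sup>2) summable_on (lat lam - {0})"
    using norm_square_le_weight[OF lam _ m]
    by (intro summable_on_comparison_test[OF w]) (auto simp: power_mult_distrib intro!: mult_right_mono)
  then show 1: "(\<lambda>k. norm k *\<^sub>R u k) square_summable_on lat lam"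
    by (rule summable_on_cong_neutral[THEN iffD1, rotated -1]) auto
  show "u square_summable_on lat lam"
  proof (rule summable_on_comparison_test[OF 1])
    fix k :: "real ^ 'd" assume k: "k \<in> lat lam"
    show "(norm (u k))\<^sup>2 \<le> (norm (norm k *\<^sub>R u k))\<^sup>2"
    proof (cases "k = 0")
      case True
      then show ?thesis using u by (simp add: Vm_def)
    next
      case False
      then have "1 * norm (u k) \<le> norm k * norm (u k)"
        by (intro mult_right_mono lat_norm_ge_1[OF lam k]) auto
      then show ?thesis by (intro power_mono) auto
    qed
  qed auto
qed

text \<open>By Hermitian symmetry the derivative of the sum of b(u, u) is the sum of b(u', u) plus
  conjugates, so conservation reduces to the balance \<open>zero\<close>. The admissible growth
  |k|^2 of the form covers all three invariants.\<close>

lemma hermitian_form_constant: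
  fixes b :: "real ^ 'd \<Rightarrow> complex ^ 'd \<Rightarrow> complex ^ 'd \<Rightarrow> complex"
  assumes lam: "1 < lam" and m: "1 \<le> m" and C1: "C1_Vm lam m T u u'"
    and bil: "\<And>k. k \<in> lat lam - {0} \<Longrightarrow> bounded_bilinear (b k)"
    and herm: "\<And>k x y. b k y x = cnj (b k x y)"
    and bound: "\<And>k x y. k \<in> lat lam - {0} \<Longrightarrow> norm (b k x y) \<le> c * ((norm k)\<^sup>2 * (norm x * norm y))"
    and c: "0 \<le> c"
    and zero: "\<And>t. t \<in> {0..<T} \<Longrightarrow> (\<Sum>\<^sub>\<infinity>k\<in>lat lam - {0}. b k (u' t k) (u t k)) = 0"
    and st: "s \<in> {0..<T}" "t \<in> {0..<T}"
  shows "(\<Sum>\<^sub>\<infinity>k\<in>lat lam - {0}. b k (u s k) (u s k)) = (\<Sum>\<^sub>\<infinity>k\<in>lat lam - {0}. b k (u t k) (u t k))"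
proof -
  let ?X = "lat lam - {0} :: (real ^ 'd) set"
  let ?w = "\<lambda>k :: real ^ 'd. norm k ^ (2 * m)"
  have bound': "norm (b k x y) \<le> c * (?w k * (norm x * norm y))" if "k \<in> ?X" for k x y
    using norm_square_le_weight[OF lam that m] c
    by (intro order.trans[OF bound[OF that]] mult_left_mono mult_right_mono) auto
  have u: "(\<lambda>k. ?w k * (norm (u r k))\<^sup>2) summable_on ?X"
    and u': "(\<lambda>k. ?w k * (norm (u' r k))\<^sup>2) summable_on ?X" if "r \<in> {0..<T}" for r
    using C1 that by (auto simp: C1_Vm_def Vm_def norm_vec_square)
  have "((\<lambda>s. \<Sum>\<^sub>\<infinity>k\<in>?X. b k (u s k) (u s k)) has_vector_derivative 0) (at r within {0..<T})"
    if r: "r \<in> {0..<T}" for r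
  proof -
    have "((\<lambda>s. sqrt (\<Sum>\<^sub>\<infinity>k\<in>?X. ?w k * (norm ((1 / (s - r)) *\<^sub>R (u s k - u r k) - u' r k))\<^sup>2)) \<longlongrightarrow> 0)
        (at r within {0..<T})"
      using C1 r unfolding C1_Vm_def hm_norm_def hm_sq_def norm_vec_square by blast
    from quadratic_form_has_vector_derivative[where b = b and w = ?w and c = c and u = u and u' = u' and t = r
        and I = "{0..<T}" and X = ?X, OF bil _ bound' c u u'[OF r] r this]
    have "((\<lambda>s. \<Sum>\<^sub>\<infinity>k\<in>?X. b k (u s k) (u s k)) has_vector_derivative
        (\<Sum>\<^sub>\<infinity>k\<in>?X. b k (u' r k) (u r k) + b k (u r k) (u' r k))) (at r within {0..<T})"
      by simp
    moreover have "(\<lambda>k. b k (u' r k) (u r k)) summable_on ?X"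
      by (rule summable_on_weighted_bilinear(1)[OF _ bound' c u'[OF r] u[OF r]]) auto
    then have "(\<Sum>\<^sub>\<infinity>k\<in>?X. b k (u' r k) (u r k) + b k (u r k) (u' r k)) = 0"
      using zero[OF r] by (simp add: herm[of _ "u' r _"] infsum_add)
    ultimately show ?thesis by simp
  qed
  then obtain a where "\<And>r. r \<in> {0..<T} \<Longrightarrow> (\<Sum>\<^sub>\<infinity>k\<in>?X. b k (u r k) (u r k)) = a"
    by (rule has_vector_derivative_zero_constant[of "{0..<T}", rotated]) auto
  then show ?thesis using st by metis
qed

section \<open>Sums over triads\<close>

lemma infsum_sum_finite:
  fixes f :: "'j \<Rightarrow> 'k \<Rightarrow> 'a::{topological_comm_monoid_add, t2_space}"
  assumes "finite J" "\<And>j. j \<in> J \<Longrightarrow> f j summable_on A"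
  shows "(\<lambda>x. \<Sum>j\<in>J. f j x) summable_on A \<and>
         (\<Sum>\<^sub>\<infinity>x\<in>A. \<Sum>j\<in>J. f j x) = (\<Sum>j\<in>J. infsum (f j) A)"
  using assms
proof (induction J rule: finite_induct)
  case (insert j J)
  then show ?case by (auto intro: summable_on_add simp: infsum_add)
qed simp

lemma infsum_partition:
  fixes f :: "'a \<Rightarrow> 'c::banach"
  assumes f: "f summable_on A" and g: "g ` A \<subseteq> B"
  shows "(\<Sum>\<^sub>\<infinity>y\<in>B. infsum f {x \<in> A. g x = y}) = infsum f A"
    and "(\<lambda>y. infsum f {x \<in> A. g x = y}) summable_on B"
proof -
  let ?S = "Sigma B (\<lambda>y. {x \<in> A. g x = y})"
  have "bij_betw snd ?S A"
    using g by (intro bij_betwI[where g = "\<lambda>x. (g x, x)"]) auto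
  note re = infsum_reindex_bij_betw[OF this, of f] summable_on_reindex_bij_betw[OF this, of f]
  have summable: "(\<lambda>(y, x). f x) summable_on ?S"
    using re(2) f by (simp add: case_prod_unfold)
  show "(\<lambda>y. infsum f {x \<in> A. g x = y}) summable_on B"
    by (rule summable_on_Sigma_banach[OF summable])
  show "(\<Sum>\<^sub>\<infinity>y\<in>B. infsum f {x \<in> A. g x = y}) = infsum f A"
    using infsum_Sigma'_banach[OF summable] re(1) by (simp add: case_prod_unfold)
qed

text \<open>The involution shows that the sum equals its own negative. Reindexing and negation hold
  for \<open>infsum\<close> whether or not the sum converges, the default value 0 being compatible
  with both.\<close>

lemma infsum_antisymmetric:
  fixes f :: "'a \<Rightarrow> complex"
  assumes mem: "\<And>x. x \<in> A \<Longrightarrow> \<sigma> x \<in> A" and inv: "\<And>x. x \<in> A \<Longrightarrow> \<sigma> (\<sigma> x) = x"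
    and anti: "\<And>x. x \<in> A \<Longrightarrow> f (\<sigma> x) = - f x"
  shows "infsum f A = 0"
proof -
  have "infsum f A = infsum (\<lambda>x. - f x) A"
    by (rule infsum_reindex_bij_witness[of A \<sigma> \<sigma>]) (use assms in auto)
  then show ?thesis
    by (simp add: infsum_uminus)
qed

lemma triads_summable_comparison:
  fixes f :: "real ^ 'd \<Rightarrow> 'a::real_normed_vector" and g :: "real ^ 'd \<Rightarrow> 'b::real_normed_vector"
    and h :: "real ^ 'd \<Rightarrow> 'c::real_normed_vector" and F :: "(real ^ 'd) \<times> (real ^ 'd) \<Rightarrow> 'e::banach"
  assumes lam: "1 < lam"
    and sq: "f square_summable_on lat lam" "g square_summable_on lat lam" "h square_summable_on lat lam"
    and A: "A \<subseteq> triads lam"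
    and le: "\<And>p q. (p, q) \<in> A \<Longrightarrow> norm (F (p, q)) \<le> c * (norm (f p) * norm (g q) * norm (h (p + q)))"
  shows "F summable_on A"
proof (rule abs_summable_summable[OF Infinite_Sum.abs_summable_on_comparison_test'])
  show "(\<lambda>x. c * (case x of (p, q) \<Rightarrow> norm (f p) * norm (g q) * norm (h (p + q)))) summable_on A"
    by (intro summable_on_cmult_right summable_on_subset[OF triads_summable[OF lam sq] A])
qed (use le in auto)

abbreviation fibre :: "real \<Rightarrow> real ^ 'd \<Rightarrow> ((real ^ 'd) \<times> (real ^ 'd)) set" where
  "fibre lam k \<equiv> {(p, q). p \<in> lat lam \<and> q \<in> lat lam \<and> p + q = k}"

lemma fibre_eq: "k \<in> lat lam \<Longrightarrow> fibre lam k = {x \<in> triads lam. fst x + snd x = k}"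
  by (auto simp: triads_def)

text \<open>A single fibre is the triad estimate with the indicator of k as third function, which is
  square summable.\<close>

lemma fibre_summable_comparison:
  fixes f :: "real ^ 'd \<Rightarrow> 'a::real_normed_vector" and g :: "real ^ 'd \<Rightarrow> 'b::real_normed_vector"
    and F :: "(real ^ 'd) \<times> (real ^ 'd) \<Rightarrow> 'e::banach"
  assumes lam: "1 < lam"
    and sq: "f square_summable_on lat lam" "g square_summable_on lat lam"
    and k: "k \<in> lat lam"
    and le: "\<And>p q. (p, q) \<in> fibre lam k \<Longrightarrow> norm (F (p, q)) \<le> c * (norm (f p) * norm (g q))"
  shows "F summable_on fibre lam k"
proof (rule triads_summable_comparison[OF lam sq, where h = "\<lambda>r. of_bool (r = k) :: real"])
  have "(\<lambda>r. (norm (of_bool (r = k) :: real))\<^sup>2) summable_on {k}"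
    by simp
  then show "(\<lambda>r. of_bool (r = k) :: real) square_summable_on lat lam"
    by (rule summable_on_cong_neutral[THEN iffD1, rotated -1]) (use k in auto)
  show "fibre lam k \<subseteq> triads lam"
    using k by (auto simp: triads_def)
  show "norm (F (p, q)) \<le> c * (norm (f p) * norm (g q) * norm (of_bool (p + q = k) :: real))"
    if "(p, q) \<in> fibre lam k" for p q
    using le[OF that] that by simp
qed

section \<open>The nonlinear term\<close>

text \<open>Bilinear, without conjugation, so that it also expresses u(p) . q and the
  incompressibility condition. Hermitian products arise from it by \<open>cnjv\<close>, or by
  evaluation at -k of a field with the reality condition.\<close>

definition cdot :: "complex ^ 'd \<Rightarrow> complex ^ 'd \<Rightarrow> complex" where
  "cdot x y = (\<Sum>i\<in>UNIV. x $ i * y $ i)"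

definition cvec :: "real ^ 'd \<Rightarrow> complex ^ 'd" where
  "cvec k = (\<chi> i. of_real (k $ i))"

definition cnjv :: "complex ^ 'd \<Rightarrow> complex ^ 'd" where
  "cnjv x = (\<chi> i. cnj (x $ i))"

lemma cvec_nth [simp]: "cvec k $ i = of_real (k $ i)"
  by (simp add: cvec_def)

lemma cnjv_nth [simp]: "cnjv x $ i = cnj (x $ i)"
  by (simp add: cnjv_def)

lemma cvec_add: "cvec (p + q) = cvec p + cvec q"
  by (simp add: vec_eq_iff)

lemma cvec_minus: "cvec (- p) = - cvec p"
  by (simp add: vec_eq_iff)

lemma norm_cvec [simp]: "norm (cvec k) = norm k"
  by (simp add: norm_vec_def)

lemma norm_cnjv [simp]: "norm (cnjv x) = norm x"
  by (simp add: norm_vec_def)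

lemma cdot_commute: "cdot x y = cdot y x"
  by (simp add: cdot_def mult.commute)

lemma cdot_add: "cdot (x + y) z = cdot x z + cdot y z" "cdot x (y + z) = cdot x y + cdot x z"
  by (simp_all add: cdot_def algebra_simps sum.distrib)

lemma cdot_minus: "cdot (- x) y = - cdot x y" "cdot x (- y) = - cdot x y"
  by (simp_all add: cdot_def sum_negf)

lemma cdot_zero [simp]: "cdot 0 y = 0" "cdot x 0 = 0"
  by (simp_all add: cdot_def)

lemma cdot_sum_left: "(\<Sum>i\<in>UNIV. c * x $ i * y $ i) = c * cdot x y"
  by (simp add: cdot_def sum_distrib_left mult.assoc)

lemma norm_cdot_le: "norm (cdot x y) \<le> norm x * norm y"
proof -
  have "norm (cdot x y) \<le> (\<Sum>i\<in>UNIV. \<bar>norm (x $ i)\<bar> * \<bar>norm (y $ i)\<bar>)"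
    unfolding cdot_def by (rule sum_norm_le) (simp add: norm_mult)
  also have "\<dots> \<le> norm x * norm y"
    unfolding norm_vec_def by (rule L2_set_mult_ineq)
  finally show ?thesis .
qed

lemma ldiv_eq: "ldiv u k = \<i> * cdot (cvec k) (u k)"
  by (simp add: ldiv_def cdot_def sum_distrib_left mult.assoc)

lemma Vm_cdot:
  assumes "u \<in> Vm lam m" "k \<in> lat lam"
  shows "cdot (u k) (cvec k) = 0"
  using assms by (simp add: Vm_def ldiv_eq cdot_commute[of "u k"])

lemma Vm_uminus:
  assumes "u \<in> Vm lam m" "k \<in> lat lam"
  shows "u (- k) = cnjv (u k)"
  using assms by (simp add: Vm_def real_vfield_def vec_eq_iff)

lemma square_summable_uminus:
  fixes w :: "real ^ 'd \<Rightarrow> complex ^ 'd"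
  assumes "w square_summable_on lat lam" and "\<And>k. k \<in> lat lam \<Longrightarrow> w (- k) = cnjv (w k)"
  shows "(\<lambda>k. w (- k)) square_summable_on lat lam"
  using assms by (simp cong: summable_on_cong)

text \<open>\<open>advect\<close> is a finite sum of separate convolutions. They may be merged into
  one sum over the fibre because each converges absolutely: u and |k| u are both square
  summable.\<close>

lemma advect_eq_infsum:
  fixes u :: "real ^ 'd \<Rightarrow> complex ^ 'd"
  assumes lam: "1 < lam" and m: "1 \<le> m" and u: "u \<in> Vm lam m" and k: "k \<in> lat lam"
  shows "advect lam u k $ i = (\<Sum>\<^sub>\<infinity>(p, q)\<in>fibre lam k. \<i> * cdot (u p) (cvec q) * u q $ i)"
    and "(\<lambda>(p, q). \<i> * cdot (u p) (cvec q) * u q $ i) summable_on fibre lam k"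
proof -
  note sq = Vm_square_summable[OF lam m u]
  let ?f = "\<lambda>j (p, q). u p $ j * (\<i> * of_real (q $ j) * u q $ i)"
  have summable: "?f j summable_on fibre lam k" for j
  proof (rule fibre_summable_comparison[OF lam sq(2,1) k, of _ 1])
    fix p q
    have "norm (u p $ j) * (\<bar>q $ j\<bar> * norm (u q $ i)) \<le> norm (u p) * (norm q * norm (u q))"
      by (intro mult_mono component_le_norm_cart Finite_Cartesian_Product.norm_nth_le) auto
    then show "norm (?f j (p, q)) \<le> 1 * (norm (u p) * norm (norm q *\<^sub>R u q))"
      by (simp add: norm_mult)
  qed
  have eq: "(\<Sum>j\<in>UNIV. ?f j x) = (case x of (p, q) \<Rightarrow> \<i> * cdot (u p) (cvec q) * u q $ i)" for x
    by (simp add: split_beta cdot_def sum_distrib_left sum_distrib_right mult_ac)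
  note fin = infsum_sum_finite[of UNIV ?f "fibre lam k", OF finite summable, unfolded eq]
  then show "advect lam u k $ i = (\<Sum>\<^sub>\<infinity>(p, q)\<in>fibre lam k. \<i> * cdot (u p) (cvec q) * u q $ i)"
    by (simp add: advect_def lconv_def)
  show "(\<lambda>(p, q). \<i> * cdot (u p) (cvec q) * u q $ i) summable_on fibre lam k"
    using fin by blast
qed

text \<open>The Euler equation is tested with a real, divergence-free field w. The pressure drops
  out since k . w(-k) = 0, and the fibre sums assemble into one absolutely convergent sum over
  triads. Energy takes w = u, helicity takes for w the vorticity.\<close>

lemma infsum_nonlinear_term:
  fixes u w :: "real ^ 'd \<Rightarrow> complex ^ 'd"
  assumes lam: "1 < lam" and m: "1 \<le> m" and u: "u \<in> Vm lam m"
    and w: "w square_summable_on lat lam" "\<And>k. k \<in> lat lam \<Longrightarrow> w (- k) = cnjv (w k)"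
      "\<And>k. k \<in> lat lam \<Longrightarrow> cdot (w k) (cvec k) = 0" "w 0 = 0"
    and euler: "\<And>k i. k \<in> lat lam - {0} \<Longrightarrow>
        u' k $ i + advect lam u k $ i = - (\<i> * of_real (k $ i) * p k)"
  shows "(\<Sum>\<^sub>\<infinity>k\<in>lat lam - {0}. cdot (u' k) (w (- k)))
       = - (\<Sum>\<^sub>\<infinity>(p, q)\<in>triads lam. \<i> * cdot (u p) (cvec q) * cdot (u q) (w (- (p + q))))"
    and "(\<lambda>(p, q). \<i> * cdot (u p) (cvec q) * cdot (u q) (w (- (p + q)))) summable_on triads lam"
proof -
  define \<Theta> where "\<Theta> = (\<lambda>(p, q). \<i> * cdot (u p) (cvec q) * cdot (u q) (w (- (p + q))))"
  note sq = Vm_square_summable[OF lam m u]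
  have \<Theta>: "\<Theta> summable_on triads lam"
  proof (rule triads_summable_comparison[OF lam sq(2,1) square_summable_uminus[OF w(1,2)], of _ _ 1])
    fix p q
    have "norm (cdot (u p) (cvec q)) * norm (cdot (u q) (w (- (p + q))))
        \<le> (norm (u p) * norm (cvec q)) * (norm (u q) * norm (w (- (p + q))))"
      by (intro mult_mono norm_cdot_le) auto
    then show "norm (\<Theta> (p, q)) \<le> 1 * (norm (u p) * norm (norm q *\<^sub>R u q) * norm (w (- (p + q))))"
      by (simp add: \<Theta>_def norm_mult mult_ac)
  qed auto
  then show "(\<lambda>(p, q). \<i> * cdot (u p) (cvec q) * cdot (u q) (w (- (p + q)))) summable_on triads lam"
    by (simp add: \<Theta>_def)
  have "cdot (u' k) (w (- k)) = - infsum \<Theta> (fibre lam k)" if k: "k \<in> lat lam - {0}" for k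
  proof -
    have k': "k \<in> lat lam" using k by simp
    let ?f = "\<lambda>i (p, q). \<i> * cdot (u p) (cvec q) * u q $ i * w (- k) $ i"
    note adv = advect_eq_infsum[OF lam m u k']
    have f: "?f i summable_on fibre lam k"
        "infsum (?f i) (fibre lam k) = advect lam u k $ i * w (- k) $ i" for i
      using summable_on_cmult_left[OF adv(2), of i "w (- k) $ i"]
        infsum_cmult_left[OF adv(2), of i "w (- k) $ i"]
      by (simp_all add: adv(1) case_prod_unfold)
    have "(\<Sum>i\<in>UNIV. advect lam u k $ i * w (- k) $ i)
        = (\<Sum>\<^sub>\<infinity>x\<in>fibre lam k. \<Sum>i\<in>UNIV. ?f i x)"
      using infsum_sum_finite[of UNIV ?f "fibre lam k"] f by simp
    also have "\<dots> = infsum \<Theta> (fibre lam k)"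
      by (rule infsum_cong) (auto simp: \<Theta>_def cdot_sum_left)
    finally have "infsum \<Theta> (fibre lam k) = (\<Sum>i\<in>UNIV. advect lam u k $ i * w (- k) $ i)" ..
    moreover have "cdot (u' k) (w (- k)) + (\<Sum>i\<in>UNIV. advect lam u k $ i * w (- k) $ i)
        = (\<Sum>i\<in>UNIV. (u' k $ i + advect lam u k $ i) * w (- k) $ i)"
      by (simp add: cdot_def sum.distrib distrib_right)
    also have "\<dots> = (\<Sum>i\<in>UNIV. (\<i> * p k) * cvec (- k) $ i * w (- k) $ i)"
      using euler[OF k] by (simp add: mult_ac)
    also have "\<dots> = 0"
      using w(3)[of "- k"] k' by (subst cdot_sum_left) (simp add: cdot_commute)
    ultimately show ?thesis
      by (simp add: add_eq_0_iff)
  qed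
  then have "(\<Sum>\<^sub>\<infinity>k\<in>lat lam - {0}. cdot (u' k) (w (- k))) = (\<Sum>\<^sub>\<infinity>k\<in>lat lam - {0}. - infsum \<Theta> (fibre lam k))"
    by (rule infsum_cong)
  \<comment> \<open>No equation is available at k = 0, but the fibre over 0 contributes nothing
    since w vanishes there. With it included, the fibres partition all triads.\<close>
  also have "\<dots> = (\<Sum>\<^sub>\<infinity>k\<in>lat lam. - infsum \<Theta> (fibre lam k))"
  proof (rule infsum_cong_neutral)
    fix k :: "real ^ 'd" assume "k \<in> lat lam - (lat lam - {0})"
    then have "infsum \<Theta> (fibre lam k) = infsum (\<lambda>_. 0) (fibre lam k)"
      by (intro infsum_cong) (auto simp: \<Theta>_def w(4) simp del: minus_add_distrib)
    then show "- infsum \<Theta> (fibre lam k) = 0" by simp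
  qed auto
  also have "\<dots> = - (\<Sum>\<^sub>\<infinity>k\<in>lat lam. infsum \<Theta> {x \<in> triads lam. fst x + snd x = k})"
    unfolding infsum_uminus by (intro arg_cong[where f = uminus] infsum_cong) (simp only: fibre_eq)
  also have "\<dots> = - infsum \<Theta> (triads lam)"
    by (subst infsum_partition(1)[OF \<Theta>]) (auto simp: triads_def)
  finally show "(\<Sum>\<^sub>\<infinity>k\<in>lat lam - {0}. cdot (u' k) (w (- k)))
       = - (\<Sum>\<^sub>\<infinity>(p, q)\<in>triads lam. \<i> * cdot (u p) (cvec q) * cdot (u q) (w (- (p + q))))"
    by (simp add: \<Theta>_def)
qed

section \<open>Symmetries of triads and the Hermitian product\<close>

lemma triads_reflect:
  assumes "(p, q) \<in> triads lam"
  shows "(p, - p - q) \<in> triads lam"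
proof -
  have "- p - q = - (p + q)" by simp
  then have "- p - q \<in> lat lam \<longleftrightarrow> p + q \<in> lat lam"
    by (simp only: lat_uminus)
  with assms show ?thesis
    by (simp add: triads_def)
qed

lemma triads_swap:
  assumes "x \<in> triads lam"
  shows "prod.swap x \<in> triads lam"
  using assms by (auto simp: triads_def add.commute)

text \<open>For x = u(p), incompressibility makes the transport factor u(p) . q odd under the
  reflection of q to -p - q. This is the source of the sign in the energy and enstrophy
  cancellations.\<close>

lemma cdot_cvec_reflect:
  assumes "cdot x (cvec p) = 0"
  shows "cdot x (cvec (- (p + q))) = - cdot x (cvec q)"
  unfolding cvec_minus cvec_add cdot_minus cdot_add assms by simp

lemma cdot_cnjv_commute: "cdot y (cnjv x) = cnj (cdot x (cnjv y))"
  by (simp add: cdot_def mult.commute)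

lemma bounded_bilinear_cdot_cnjv: "bounded_bilinear (\<lambda>x y. cdot x (cnjv y))"
proof
  show "\<exists>K. \<forall>x y. norm (cdot x (cnjv y)) \<le> norm x * norm y * K"
    using norm_cdot_le[of _ "cnjv _"] by (intro exI[of _ 1]) auto
qed (simp_all add: cdot_def scaleR_conv_of_real[where 'a = complex] algebra_simps sum.distrib sum_distrib_left)

lemma vinner_eq_infsum:
  assumes "u 0 = 0"
  shows "vinner lam u v = (\<Sum>\<^sub>\<infinity>k\<in>lat lam - {0}. cdot (u k) (cnjv (v k)))"
  unfolding vinner_def by (rule infsum_cong_neutral) (auto simp: cdot_def assms)

section \<open>Energy and helicity\<close>

text \<open>With c = -(a + b) the triad term is a multiple of (u(a) . b) (u(b) . u(c)). Exchanging b
  and c preserves the second factor and reverses the sign of the first.\<close>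

lemma energy_constant:
  fixes u :: "real \<Rightarrow> real ^ 'd \<Rightarrow> complex ^ 'd"
  assumes lam: "1 < lam" and m: "1 \<le> m" and sol: "strong_euler_solution lam m T u p"
    and st: "s \<in> {0..<T}" "t \<in> {0..<T}"
  shows "energy lam (u s) = energy lam (u t)"
proof -
  obtain u' where C1: "C1_Vm lam m T u u'"
    and euler: "\<And>t k i. t \<in> {0..<T} \<Longrightarrow> k \<in> lat lam - {0} \<Longrightarrow>
      u' t k $ i + advect lam (u t) k $ i = - (\<i> * of_real (k $ i) * p t k)"
    using sol unfolding strong_euler_solution_def by blast
  have Vm: "u r \<in> Vm lam m" if "r \<in> {0..<T}" for r
    using C1 that by (simp add: C1_Vm_def)
  have zero: "u r 0 = 0" if "r \<in> {0..<T}" for r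
    using Vm[OF that] by (simp add: Vm_def)
  have "(\<Sum>\<^sub>\<infinity>k\<in>lat lam - {0}. cdot (u s k) (cnjv (u s k))) = (\<Sum>\<^sub>\<infinity>k\<in>lat lam - {0}. cdot (u t k) (cnjv (u t k)))"
  proof (rule hermitian_form_constant[where b = "\<lambda>_ x y. cdot x (cnjv y)" and c = 1, OF lam m C1 _ _ _ _ _ st])
    fix k :: "real ^ 'd" and x y :: "complex ^ 'd"
    assume k: "k \<in> lat lam - {0}"
    then have "1 \<le> (norm k)\<^sup>2"
      using lat_norm_ge_1[OF lam, of k] by (simp add: one_le_power)
    then have "1 * (norm x * norm y) \<le> (norm k)\<^sup>2 * (norm x * norm y)"
      by (intro mult_right_mono) auto
    then show "norm (cdot x (cnjv y)) \<le> 1 * ((norm k)\<^sup>2 * (norm x * norm y))"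
      using norm_cdot_le[of x "cnjv y"] by simp
  next
    fix r assume r: "r \<in> {0..<T}"
    define \<Theta> where "\<Theta> = (\<lambda>(p, q). \<i> * cdot (u r p) (cvec q) * cdot (u r q) (u r (- (p + q))))"
    have "(\<Sum>\<^sub>\<infinity>k\<in>lat lam - {0}. cdot (u' r k) (cnjv (u r k)))
        = (\<Sum>\<^sub>\<infinity>k\<in>lat lam - {0}. cdot (u' r k) (u r (- k)))"
      by (intro infsum_cong) (simp add: Vm_uminus[OF Vm[OF r]])
    also have "\<dots> = - infsum \<Theta> (triads lam)"
      unfolding \<Theta>_def
      by (rule infsum_nonlinear_term(1)[OF lam m Vm[OF r] _ _ _ _ euler[OF r]])
        (use Vm_square_summable[OF lam m Vm[OF r]] Vm_uminus[OF Vm[OF r]] Vm_cdot[OF Vm[OF r]] zero[OF r] in auto)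
    also have "infsum \<Theta> (triads lam) = 0"
    proof (rule infsum_antisymmetric[where \<sigma> = "\<lambda>(p, q). (p, - (p + q))"])
      fix x :: "(real ^ 'd) \<times> (real ^ 'd)" assume x: "x \<in> triads lam"
      obtain a b where ab: "x = (a, b)" by (cases x)
      define c where "c = - (a + b)"
      have abc: "- (a + b) = c" "- (a + c) = b" by (simp_all add: c_def)
      have "cdot (u r a) (cvec c) = - cdot (u r a) (cvec b)"
        unfolding c_def using x by (intro cdot_cvec_reflect Vm_cdot[OF Vm[OF r]]) (simp add: ab triads_def)
      then show "\<Theta> (case x of (p, q) \<Rightarrow> (p, - (p + q))) = - \<Theta> x"
        unfolding ab \<Theta>_def prod.case abc by (simp add: cdot_commute[of "u r c"])
    qed (auto simp: triads_reflect)
    finally show "(\<Sum>\<^sub>\<infinity>k\<in>lat lam - {0}. cdot (u' r k) (cnjv (u r k))) = 0"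
      by simp
  qed (rule bounded_bilinear_cdot_cnjv cdot_cnjv_commute zero_le_one)+
  then show ?thesis
    using st by (simp add: energy_def vinner_eq_infsum zero)
qed

text \<open>Since the curl at k sees only the value of the field at k, feeding it constant fields
  yields, for each k, a linear map of vectors, as needed for the form \<open>b k\<close> in
  \<open>hermitian_form_constant\<close>.\<close>

lemma vort3_local: "vort3 u k = vort3 (\<lambda>_. u k) k"
  by (simp add: vort3_def)

text \<open>The 6 counts three components with two products each, bounding the Euclidean norm by the
  sum of the moduli of the components.\<close>

lemma norm_vort3_le: "norm (vort3 (\<lambda>_. x) k) \<le> 6 * (norm k * norm x)"
proof -
  have comp: "norm (\<i> * (of_real (k $ a) * x $ b - of_real (k $ c) * x $ d)) \<le> 2 * (norm k * norm x)" for a b c d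
  proof -
    have "norm (\<i> * (of_real (k $ a) * x $ b - of_real (k $ c) * x $ d))
        \<le> \<bar>k $ a\<bar> * norm (x $ b) + \<bar>k $ c\<bar> * norm (x $ d)"
      using norm_triangle_ineq4[of "of_real (k $ a) * x $ b" "of_real (k $ c) * x $ d"]
      by (simp add: norm_mult)
    also have "\<dots> \<le> norm k * norm x + norm k * norm x"
      by (intro add_mono mult_mono component_le_norm_cart Finite_Cartesian_Product.norm_nth_le) auto
    finally show ?thesis by simp
  qed
  have "norm (vort3 (\<lambda>_. x) k) \<le> (\<Sum>i\<in>UNIV. norm (vort3 (\<lambda>_. x) k $ i))"
    unfolding norm_vec_def by (rule L2_set_le_sum) simp
  also have "\<dots> \<le> 2 * (norm k * norm x) + 2 * (norm k * norm x) + 2 * (norm k * norm x)"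
    unfolding sum_3 by (intro add_mono) (simp_all only: vort3_def vec_lambda_beta comp if_True if_False split: if_split, simp_all add: comp)
  finally show ?thesis by simp
qed

text \<open>The nonlinearity is split as u . grad u = \<omega> x u + grad (|u|^2 / 2). The gradient
  part vanishes against the divergence-free \<omega>, and the other part is perpendicular to
  \<omega>. Both statements become antisymmetries of triad sums. The form is Hermitian because the
  symbol of curl, i k x, is a Hermitian matrix.\<close>

lemma helicity_constant:
  fixes u :: "real \<Rightarrow> real ^ 3 \<Rightarrow> complex ^ 3"
  assumes lam: "1 < lam" and m: "1 \<le> m" and sol: "strong_euler_solution lam m T u p"
    and st: "s \<in> {0..<T}" "t \<in> {0..<T}"
  shows "helicity lam (u s) = helicity lam (u t)"
proof -
  obtain u' where C1: "C1_Vm lam m T u u'"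
    and euler: "\<And>t k i. t \<in> {0..<T} \<Longrightarrow> k \<in> lat lam - {0} \<Longrightarrow>
      u' t k $ i + advect lam (u t) k $ i = - (\<i> * of_real (k $ i) * p t k)"
    using sol unfolding strong_euler_solution_def by blast
  have Vm: "u r \<in> Vm lam m" if "r \<in> {0..<T}" for r
    using C1 that by (simp add: C1_Vm_def)
  have zero: "u r 0 = 0" if "r \<in> {0..<T}" for r
    using Vm[OF that] by (simp add: Vm_def)
  have bound: "norm (cdot x (cnjv (vort3 (\<lambda>_. y) k))) \<le> 6 * norm k * (norm x * norm y)" for k x y
    using order.trans[OF norm_cdot_le[of x "cnjv (vort3 (\<lambda>_. y) k)"]
        mult_left_mono[OF norm_vort3_le[of y k, folded norm_cnjv[of "vort3 (\<lambda>_. y) k"]] norm_ge_zero[of x]]]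
    by (simp add: mult_ac)
  have "(\<Sum>\<^sub>\<infinity>k\<in>lat lam - {0}. cdot (u s k) (cnjv (vort3 (\<lambda>_. u s k) k)))
      = (\<Sum>\<^sub>\<infinity>k\<in>lat lam - {0}. cdot (u t k) (cnjv (vort3 (\<lambda>_. u t k) k)))"
  proof (rule hermitian_form_constant[where b = "\<lambda>k x y. cdot x (cnjv (vort3 (\<lambda>_. y) k))" and c = 6, OF lam m C1 _ _ _ _ _ st])
    fix k :: "real ^ 3"
    show "bounded_bilinear (\<lambda>x y. cdot x (cnjv (vort3 (\<lambda>_. y) k)))"
    proof
      show "\<exists>K. \<forall>x y. norm (cdot x (cnjv (vort3 (\<lambda>_. y) k))) \<le> norm x * norm y * K"
        using bound[of _ _ k] by (intro exI[of _ "6 * norm k"]) (simp add: mult_ac)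
    qed (simp_all add: cdot_def sum_3 vort3_def scaleR_conv_of_real[where 'a = complex] algebra_simps)
  next
    fix k :: "real ^ 3" and x y :: "complex ^ 3"
    show "cdot y (cnjv (vort3 (\<lambda>_. x) k)) = cnj (cdot x (cnjv (vort3 (\<lambda>_. y) k)))"
      by (simp add: cdot_def sum_3 vort3_def algebra_simps)
  next
    fix k :: "real ^ 3" and x y :: "complex ^ 3"
    assume "k \<in> lat lam - {0}"
    then have "norm k * 1 \<le> norm k * norm k"
      using lat_norm_ge_1[OF lam] by (intro mult_left_mono) auto
    then have "norm k * (norm x * norm y) \<le> (norm k)\<^sup>2 * (norm x * norm y)"
      by (intro mult_right_mono) (auto simp: power2_eq_square)
    then show "norm (cdot x (cnjv (vort3 (\<lambda>_. y) k))) \<le> 6 * ((norm k)\<^sup>2 * (norm x * norm y))"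
      using bound[of x y k] by (simp add: mult_ac)
  next
    fix r assume r: "r \<in> {0..<T}"
    define w where "w = vort3 (u r)"
    note V = Vm[OF r] and sq = Vm_square_summable[OF lam m Vm[OF r]]
    have w_local: "w k = vort3 (\<lambda>_. u r k) k" for k
      unfolding w_def by (rule vort3_local)
    have w_le: "norm (w k) \<le> 6 * (norm k * norm (u r k))" for k
      unfolding w_local by (rule norm_vort3_le)
    have w_sq: "w square_summable_on lat lam"
    proof (rule summable_on_comparison_test[OF summable_on_cmult_right[OF sq(1), of 36]])
      show "(norm (w k))\<^sup>2 \<le> 36 * (norm (norm k *\<^sub>R u r k))\<^sup>2" for k
        using power_mono[OF w_le[of k], of 2] by (simp add: power_mult_distrib)
    qed auto
    have w_uminus: "w (- k) = cnjv (w k)" if "k \<in> lat lam" for k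
      using Vm_uminus[OF V that] by (simp add: w_def vort3_def vec_eq_iff algebra_simps)
    have w_cdot: "cdot (w k) (cvec k) = 0" for k
      by (simp add: w_def cdot_def sum_3 vort3_def algebra_simps)
    have w_zero: "w 0 = 0"
      by (simp add: w_def vort3_def vec_eq_iff)
    define \<Theta> where "\<Theta> = (\<lambda>(p, q). \<i> * cdot (u r p) (cvec q) * cdot (u r q) (w (- (p + q))))"
    \<comment> \<open>The gradient part: averaging over the exchange of p and q replaces q in the
      last factor by (p + q) / 2, which is orthogonal to w(-(p + q)).\<close>
    define \<beta> where "\<beta> = (\<lambda>(p, q). \<i> * cdot (u r p) (u r q) * cdot (cvec q) (w (- (p + q))))"
    note nonlinear = infsum_nonlinear_term[OF lam m V w_sq w_uminus w_cdot w_zero euler[OF r], folded \<Theta>_def]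
    have \<beta>: "\<beta> summable_on triads lam"
    proof (rule triads_summable_comparison[OF lam sq(2,1) square_summable_uminus[OF w_sq w_uminus], of _ _ 1])
      fix p q
      have "norm (cdot (u r p) (u r q)) * norm (cdot (cvec q) (w (- (p + q))))
          \<le> (norm (u r p) * norm (u r q)) * (norm (cvec q) * norm (w (- (p + q))))"
        by (intro mult_mono norm_cdot_le) auto
      then show "norm (\<beta> (p, q)) \<le> 1 * (norm (u r p) * norm (norm q *\<^sub>R u r q) * norm (w (- (p + q))))"
        by (simp add: \<beta>_def norm_mult mult_ac)
    qed auto
    have \<alpha>: "(\<lambda>x. \<Theta> x + (- 1) * \<beta> x) summable_on triads lam"
      by (intro summable_on_add nonlinear(2) summable_on_cmult_right \<beta>)
    have "infsum \<Theta> (triads lam) = (\<Sum>\<^sub>\<infinity>x\<in>triads lam. (\<Theta> x + (- 1) * \<beta> x) + \<beta> x)"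
      by simp
    also have "\<dots> = (\<Sum>\<^sub>\<infinity>x\<in>triads lam. \<Theta> x + (- 1) * \<beta> x) + infsum \<beta> (triads lam)"
      by (rule infsum_add[OF \<alpha> \<beta>])
    also have "infsum \<beta> (triads lam) = 0"
    proof (rule infsum_antisymmetric[where \<sigma> = prod.swap])
      fix x :: "(real ^ 3) \<times> (real ^ 3)" assume x: "x \<in> triads lam"
      obtain a b where ab: "x = (a, b)" by (cases x)
      have neg: "cdot (cvec (- (a + b))) z = - (cdot (cvec a) z + cdot (cvec b) z)" for z
        unfolding cvec_minus cvec_add cdot_minus cdot_add ..
      have "cdot (cvec (- (a + b))) (w (- (a + b))) = 0"
        using w_cdot[of "- (a + b)"] by (simp only: cdot_commute)
      then have "cdot (cvec a) (w (- (a + b))) = - cdot (cvec b) (w (- (a + b)))"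
        unfolding neg by (simp only: neg_equal_0_iff_equal eq_neg_iff_add_eq_0)
      then show "\<beta> (prod.swap x) = - \<beta> x"
        by (simp add: \<beta>_def ab add.commute[of b a] cdot_commute[of "u r b"] del: minus_add_distrib)
    qed (auto simp: triads_swap)
    also have "(\<Sum>\<^sub>\<infinity>x\<in>triads lam. \<Theta> x + (- 1) * \<beta> x) = 0"
    proof (rule infsum_antisymmetric[where \<sigma> = "\<lambda>(p, q). (p, - (p + q))"])
      fix x :: "(real ^ 3) \<times> (real ^ 3)" assume x: "x \<in> triads lam"
      obtain a b where ab: "x = (a, b)" by (cases x)
      define c where "c = - (a + b)"
      have abc: "- (a + b) = c" "- (a + c) = b" by (simp_all add: c_def)
      \<comment> \<open>Up to a constant factor, both sides are the triple product \<open>(\<omega>(b) \<times> u(a)) \<cdot> \<omega>(c)\<close>.\<close>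
      have "cdot (u r a) (cvec b) * cdot (u r b) (w c) - cdot (u r a) (u r b) * cdot (cvec b) (w c)
          = - (cdot (u r a) (cvec c) * cdot (u r c) (w b) - cdot (u r a) (u r c) * cdot (cvec c) (w b))"
        by (simp add: w_def vort3_def cdot_def sum_3 algebra_simps)
      then show "\<Theta> (case x of (p, q) \<Rightarrow> (p, - (p + q))) + (- 1) * \<beta> (case x of (p, q) \<Rightarrow> (p, - (p + q)))
          = - (\<Theta> x + (- 1) * \<beta> x)"
        unfolding ab \<Theta>_def \<beta>_def prod.case abc by algebra
    qed (auto simp: triads_reflect)
    finally have "infsum \<Theta> (triads lam) = 0" by simp
    moreover have "(\<Sum>\<^sub>\<infinity>k\<in>lat lam - {0}. cdot (u' r k) (cnjv (vort3 (\<lambda>_. u r k) k)))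
        = (\<Sum>\<^sub>\<infinity>k\<in>lat lam - {0}. cdot (u' r k) (w (- k)))"
      by (intro infsum_cong) (simp add: w_uminus w_local[symmetric])
    ultimately show "(\<Sum>\<^sub>\<infinity>k\<in>lat lam - {0}. cdot (u' r k) (cnjv (vort3 (\<lambda>_. u r k) k))) = 0"
      using nonlinear(1) by simp
  qed auto
  then show ?thesis
    using st by (simp add: helicity_def vinner_eq_infsum zero flip: vort3_local)
qed

section \<open>Enstrophy\<close>

text \<open>In contrast to the Euclidean norm this is the modulus of a single coordinate, to which
  the one-dimensional triad estimate applies.\<close>

definition maxnorm :: "real ^ 'd \<Rightarrow> real" where
  "maxnorm k = Max (range (\<lambda>i. \<bar>k $ i\<bar>))"

lemma component_le_maxnorm: "\<bar>k $ i\<bar> \<le> maxnorm k"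
  unfolding maxnorm_def by (rule Max_ge) auto

lemma maxnorm_attained: "\<exists>i. maxnorm k = \<bar>k $ i\<bar>"
proof -
  have "maxnorm k \<in> range (\<lambda>i. \<bar>k $ i\<bar>)"
    unfolding maxnorm_def by (rule Max_in) auto
  then show ?thesis by blast
qed

lemma maxnorm_uminus [simp]: "maxnorm (- k) = maxnorm k"
  by (simp add: maxnorm_def)

lemma norm_le_maxnorm:
  fixes k :: "real ^ 'd"
  shows "norm k \<le> real CARD('d) * maxnorm k"
proof -
  have "norm k \<le> (\<Sum>i\<in>UNIV. \<bar>k $ i\<bar>)"
    by (rule norm_le_l1_cart)
  also have "\<dots> \<le> real CARD('d) * maxnorm k"
    using sum_bounded_above[of UNIV "\<lambda>i. \<bar>k $ i\<bar>" "maxnorm k", OF component_le_maxnorm] by simp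
  finally show ?thesis .
qed

text \<open>The exponents are nonnegative, so powers do not accumulate at 0 and an upper bound
  leaves finitely many values for each coordinate.\<close>

lemma finite_maxnorm_shell:
  assumes lam: "1 < lam"
  shows "finite {k \<in> lat lam. maxnorm k = \<rho>}"
proof -
  obtain B where B: "\<rho> < lam ^ B"
    using real_arch_pow[OF lam] by blast
  let ?S = "{0} \<union> (\<lambda>n. lam ^ n) ` {..<B} \<union> (\<lambda>n. - (lam ^ n)) ` {..<B}"
  have small: "x \<in> ?S" if x: "x \<in> lat1 lam" "\<bar>x\<bar> \<le> \<rho>" for x
  proof -
    have "n < B" if "lam ^ n \<le> \<rho>" for n
      using that B lam by (metis le_less_trans power_less_imp_less_exp)
    then show ?thesis
      using x lam by (fastforce simp: lat1_def power_abs)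
  qed
  have "k \<in> (\<lambda>\<phi>. \<chi> i. \<phi> i) ` (Pi\<^sub>E UNIV (\<lambda>_. ?S))" if "k \<in> lat lam" "maxnorm k = \<rho>" for k
  proof (rule image_eqI)
    show "k = (\<chi> i. k $ i)" by simp
    show "(($) k) \<in> Pi\<^sub>E UNIV (\<lambda>_. ?S)"
      unfolding PiE_UNIV_domain Pi_def mem_Collect_eq
      using that component_le_maxnorm[of k] by (intro allI impI small) (auto simp: lat_def)
  qed
  then have "{k \<in> lat lam. maxnorm k = \<rho>} \<subseteq> (\<lambda>\<phi>. \<chi> i. \<phi> i) ` (Pi\<^sub>E UNIV (\<lambda>_. ?S))"
    by blast
  then show ?thesis
    by (rule finite_subset) (intro finite_imageI finite_PiE; simp)
qed

text \<open>Where \<open>q\<close> and \<open>p + q\<close> are large compared with \<open>p\<close> in some coordinate, \<open>p\<close> vanishes there; hence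
  large components cannot make the two maximum norms differ. This fails for the Euclidean norm.\<close>

lemma triad_maxnorm_neq:
  fixes p q :: "real ^ 'd"
  assumes lam: "1 < lam" and pq: "(p, q) \<in> triads lam" and neq: "maxnorm q \<noteq> maxnorm (p + q)"
  shows "norm q \<le> real CARD('d) * (lam / (lam - 1)) * norm p"
proof -
  define R where "R = lam / (lam - 1)"
  have R: "1 \<le> R" using lam by (simp add: R_def)
  have mem: "p $ i \<in> lat1 lam" "q $ i \<in> lat1 lam" "p $ i + q $ i \<in> lat1 lam" for i
    using pq by (auto simp: triads_def lat_def)
  have Rp: "\<bar>p $ i\<bar> \<le> R * \<bar>p $ i\<bar>" for i
    using mult_right_mono[OF R, of "\<bar>p $ i\<bar>"] by simp
  have Rle: "R * \<bar>p $ i\<bar> \<le> R * norm p" for i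
    using R component_le_norm_cart[of p i] by (intro mult_left_mono) auto
  \<comment> \<open>By \<open>lat1_triad_ratio\<close> some entry of this coordinate triad is zero.
    It is not q_i, which is too large, and p_i + q_i = 0 would give |q_i| = |p_i| <= R |p_i|. The
    companion \<open>pq_large\<close> is the same with p + q in place of q.\<close>
  have q_large: "p $ i = 0" if "R * \<bar>p $ i\<bar> < \<bar>q $ i\<bar>" for i
    using lat1_triad_ratio[OF lam mem(1,2,3), of i] that Rp[of i] unfolding R_def[symmetric]
    by (cases "q $ i = 0"; cases "p $ i + q $ i = 0") auto
  have pq_large: "p $ i = 0" if "R * \<bar>p $ i\<bar> < \<bar>p $ i + q $ i\<bar>" for i
    using lat1_triad_ratio[OF lam, of "- p $ i" "p $ i + q $ i"] mem[of i] that Rp[of i] unfolding R_def[symmetric]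
    by (cases "q $ i = 0"; cases "p $ i + q $ i = 0") auto
  obtain i j where i: "maxnorm q = \<bar>q $ i\<bar>" and j: "maxnorm (p + q) = \<bar>p $ j + q $ j\<bar>"
    using maxnorm_attained[of q] maxnorm_attained[of "p + q"] by auto
  \<comment> \<open>Otherwise p vanishes where q attains its maximum, so p + q has the strictly
    larger maximum norm. Then p also vanishes where p + q attains it, and q has a component
    exceeding its own maximum norm.\<close>
  have "maxnorm q \<le> R * norm p"
  proof (rule ccontr)
    assume large: "\<not> maxnorm q \<le> R * norm p"
    then have "p $ i = 0"
      using Rle[of i] i by (intro q_large) auto
    then have less: "maxnorm q < maxnorm (p + q)"
      using component_le_maxnorm[of "p + q" i] i neq by simp
    then have "p $ j = 0"
      using Rle[of j] j large by (intro pq_large) auto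
    then show False
      using component_le_maxnorm[of q j] j less by simp
  qed
  then have "real CARD('d) * maxnorm q \<le> real CARD('d) * (R * norm p)"
    by (rule mult_left_mono) simp
  then show ?thesis
    using norm_le_maxnorm[of q] by (simp add: R_def mult.assoc)
qed

text \<open>The sum over k of fibre sums need not be an absolutely convergent sum over triads, so it
  cannot be reindexed directly. The reflection exchanges the maximum norms of q and p + q, hence
  preserves both D and E. D is reindexed as a whole. E is never summed as a whole: restricting k to
  one maximum norm restricts q to it as well, and within such a shell the reflection acts on a
  finite set.\<close>

lemma infsum_antisymmetric_triads:
  fixes \<Gamma> :: "(real ^ 'd) \<times> (real ^ 'd) \<Rightarrow> complex"
  assumes lam: "1 < lam"
    and fib: "\<And>k. k \<in> lat lam \<Longrightarrow> \<Gamma> summable_on fibre lam k"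
    and total: "(\<lambda>k. infsum \<Gamma> (fibre lam k)) summable_on lat lam"
    and off: "\<Gamma> summable_on {(p, q) \<in> triads lam. maxnorm q \<noteq> maxnorm (p + q)}"
    and anti: "\<And>p q. (p, q) \<in> triads lam \<Longrightarrow> \<Gamma> (p, - p - q) = - \<Gamma> (p, q)"
  shows "(\<Sum>\<^sub>\<infinity>k\<in>lat lam. infsum \<Gamma> (fibre lam k)) = 0"
proof -
  define D :: "((real ^ 'd) \<times> (real ^ 'd)) set" where "D = {(p, q) \<in> triads lam. maxnorm q \<noteq> maxnorm (p + q)}"
  define E :: "((real ^ 'd) \<times> (real ^ 'd)) set" where "E = {(p, q) \<in> triads lam. maxnorm q = maxnorm (p + q)}"
  define G1 where "G1 k = infsum \<Gamma> {x \<in> D. fst x + snd x = k}" for k :: "real ^ 'd"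
  define G2 where "G2 k = infsum \<Gamma> {x \<in> E. fst x + snd x = k}" for k :: "real ^ 'd"
  have minus: "maxnorm (- p - q) = maxnorm (p + q)" for p q :: "real ^ 'd"
    using maxnorm_uminus[of "p + q"] by simp
  have D: "(\<lambda>x. fst x + snd x) ` D \<subseteq> lat lam"
    by (auto simp: D_def triads_def)
  have G1: "infsum G1 (lat lam) = infsum \<Gamma> D" "G1 summable_on lat lam"
    using infsum_partition[OF off[folded D_def] D] by (simp_all add: G1_def[abs_def])
  have "infsum \<Gamma> D = 0"
    by (rule infsum_antisymmetric[where \<sigma> = "\<lambda>(p, q). (p, - p - q)"])
      (auto simp: D_def anti triads_reflect minus)
  with G1 have G1_zero: "infsum G1 (lat lam) = 0" by simp
  have split: "infsum \<Gamma> (fibre lam k) = G1 k + G2 k" if k: "k \<in> lat lam" for k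
  proof -
    have un: "fibre lam k = {x \<in> D. fst x + snd x = k} \<union> {x \<in> E. fst x + snd x = k}"
      using k by (auto simp: D_def E_def triads_def)
    have "\<Gamma> summable_on {x \<in> D. fst x + snd x = k}" "\<Gamma> summable_on {x \<in> E. fst x + snd x = k}"
      by (rule summable_on_subset[OF fib[OF k]]; auto simp: D_def E_def triads_def)+
    then show ?thesis
      unfolding un G1_def G2_def by (rule infsum_Un_disjoint) (auto simp: D_def E_def)
  qed
  \<comment> \<open>Summability of \<open>G2\<close> is obtained by subtraction, as there is no
    bound on the individual terms over E. It permits grouping the sum over k by shells.\<close>
  have "(\<lambda>k. infsum \<Gamma> (fibre lam k) + (- 1) * G1 k) summable_on lat lam"
    by (intro summable_on_add total summable_on_cmult_right G1(2))
  then have G2: "G2 summable_on lat lam"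
    by (rule summable_on_cong[THEN iffD1, rotated]) (simp add: split)
  have shell: "infsum G2 {k \<in> lat lam. maxnorm k = \<rho>} = 0" for \<rho>
  proof -
    \<comment> \<open>A triad is determined by q and p + q, both now in one finite shell, so F is
      finite. The reflection interchanges its two conditions.\<close>
    define F :: "((real ^ 'd) \<times> (real ^ 'd)) set"
      where "F = {(p, q) \<in> triads lam. maxnorm q = \<rho> \<and> maxnorm (p + q) = \<rho>}"
    have "F \<subseteq> (\<lambda>(k, q). (k - q, q)) ` ({k \<in> lat lam. maxnorm k = \<rho>} \<times> {k \<in> lat lam. maxnorm k = \<rho>})"
    proof
      fix x assume "x \<in> F"
      then show "x \<in> (\<lambda>(k, q). (k - q, q)) ` ({k \<in> lat lam. maxnorm k = \<rho>} \<times> {k \<in> lat lam. maxnorm k = \<rho>})"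
        by (intro image_eqI[where x = "(fst x + snd x, snd x)"]) (auto simp: F_def triads_def)
    qed
    then have "finite F"
      by (rule finite_subset) (intro finite_imageI finite_cartesian_product finite_maxnorm_shell lam)
    have "infsum G2 {k \<in> lat lam. maxnorm k = \<rho>}
        = (\<Sum>\<^sub>\<infinity>k\<in>{k \<in> lat lam. maxnorm k = \<rho>}. infsum \<Gamma> {x \<in> F. fst x + snd x = k})"
    proof (rule infsum_cong)
      fix k :: "real ^ 'd" assume k: "k \<in> {k \<in> lat lam. maxnorm k = \<rho>}"
      have "x \<in> E \<longleftrightarrow> x \<in> F" if "fst x + snd x = k" for x
      proof (cases x)
        case (Pair p q)
        with that k have "maxnorm (p + q) = \<rho>" by simp
        then show ?thesis
          unfolding Pair E_def F_def by simp
      qed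
      then have "{x \<in> E. fst x + snd x = k} = {x \<in> F. fst x + snd x = k}"
        by blast
      then show "G2 k = infsum \<Gamma> {x \<in> F. fst x + snd x = k}"
        by (simp only: G2_def)
    qed
    also have "\<dots> = infsum \<Gamma> F"
      using \<open>finite F\<close> by (intro infsum_partition(1)) (auto simp: F_def triads_def)
    also have "\<dots> = 0"
      by (rule infsum_antisymmetric[where \<sigma> = "\<lambda>(p, q). (p, - p - q)"])
        (auto simp: F_def anti triads_reflect minus)
    finally show ?thesis .
  qed
  have "infsum G2 (lat lam) = (\<Sum>\<^sub>\<infinity>\<rho>\<in>UNIV. infsum G2 {k \<in> lat lam. maxnorm k = \<rho>})"
    by (rule infsum_partition(1)[OF G2, symmetric]) simp
  then have "infsum G2 (lat lam) = 0"
    by (simp add: shell)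
  moreover have "(\<Sum>\<^sub>\<infinity>k\<in>lat lam. infsum \<Gamma> (fibre lam k)) = (\<Sum>\<^sub>\<infinity>k\<in>lat lam. G1 k + G2 k)"
    by (intro infsum_cong split)
  moreover have "\<dots> = infsum G1 (lat lam) + infsum G2 (lat lam)"
    by (rule infsum_add[OF G1(2) G2])
  ultimately show ?thesis
    using G1_zero by simp
qed

section \<open>The vorticity equation in the plane\<close>

definition cross2 :: "real ^ 2 \<Rightarrow> complex ^ 2 \<Rightarrow> complex" where
  "cross2 k x = of_real (k $ 1) * x $ 2 - of_real (k $ 2) * x $ 1"

lemma vort2_eq_cross2: "vort2 u k = \<i> * cross2 k (u k)"
  by (simp add: vort2_def cross2_def)

lemma norm_cross2_le: "norm (cross2 k x) \<le> 2 * (norm k * norm x)"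
proof -
  have "norm (cross2 k x) \<le> \<bar>k $ 1\<bar> * norm (x $ 2) + \<bar>k $ 2\<bar> * norm (x $ 1)"
    using norm_triangle_ineq4[of "of_real (k $ 1) * x $ 2" "of_real (k $ 2) * x $ 1"]
    by (simp add: cross2_def norm_mult)
  also have "\<dots> \<le> norm k * norm x + norm k * norm x"
    by (intro add_mono mult_mono component_le_norm_cart Finite_Cartesian_Product.norm_nth_le) auto
  finally show ?thesis by simp
qed

text \<open>For nonzero p and q, x and y are multiples of the rotated vectors of p and q. The two
  terms are then the same multiple of (p x q) (p . q) with opposite signs. This expresses the
  absence of vortex stretching in the plane.\<close>

lemma cross2_exchange:
  assumes "cdot x (cvec p) = 0" "cdot y (cvec q) = 0"
  shows "cdot x (cvec q) * cross2 p y + cdot y (cvec p) * cross2 q x = 0"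
  using assms unfolding cdot_def cross2_def sum_2 cvec_nth by algebra

text \<open>The transport form is needed because the triad sum of the enstrophy balance need not converge
  absolutely for fields in \<open>V^1\<close>.\<close>

lemma infsum_curl_advect:
  fixes u :: "real ^ 2 \<Rightarrow> complex ^ 2"
  assumes lam: "1 < lam" and m: "1 \<le> m" and u: "u \<in> Vm lam m" and k: "k \<in> lat lam"
  shows "(\<lambda>(p, q). \<i> * cdot (u p) (cvec q) * vort2 u q) summable_on fibre lam k"
    and "(\<Sum>\<^sub>\<infinity>(p, q)\<in>fibre lam k. \<i> * cdot (u p) (cvec q) * vort2 u q) = vort2 (advect lam u) k"
proof -
  note sq = Vm_square_summable[OF lam m u]
  note adv = advect_eq_infsum[OF lam m u k]
  define \<Psi> where "\<Psi> = (\<lambda>(p, q). \<i> * cdot (u p) (cvec q) * vort2 u q)"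
  \<comment> \<open>The curl at k = p + q splits as \<open>cross2 p (u q)\<close> plus
    \<open>cross2 q (u q)\<close>. The second part is the transport of vorticity \<Psi>; the first
    is this \<Psi>', which cancels under exchange of p and q.\<close>
  define \<Psi>' where "\<Psi>' = (\<lambda>(p, q). - (cdot (u p) (cvec q) * cross2 p (u q)))"
  let ?f = "\<lambda>i (p, q). \<i> * cdot (u p) (cvec q) * u q $ i"
  have f: "?f i summable_on fibre lam k" "infsum (?f i) (fibre lam k) = advect lam u k $ i" for i
    using adv by auto
  let ?S = "\<lambda>x. \<i> * of_real (k $ 1) * ?f 2 x + (- \<i>) * of_real (k $ 2) * ?f 1 x"
  have S: "?S summable_on fibre lam k"
    by (intro summable_on_add summable_on_cmult_right f)
  have S_sum: "infsum ?S (fibre lam k) = vort2 (advect lam u) k"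
  proof -
    have "infsum ?S (fibre lam k)
        = \<i> * of_real (k $ 1) * infsum (?f 2) (fibre lam k) + (- \<i>) * of_real (k $ 2) * infsum (?f 1) (fibre lam k)"
      by (simp only: infsum_add[OF summable_on_cmult_right[OF f(1)[of 2]] summable_on_cmult_right[OF f(1)[of 1]]]
        infsum_cmult_right[OF f(1)[of 2]] infsum_cmult_right[OF f(1)[of 1]])
    also have "\<dots> = vort2 (advect lam u) k"
      unfolding f(2) by (simp add: vort2_def algebra_simps)
    finally show ?thesis .
  qed
  have \<Psi>': "\<Psi>' summable_on fibre lam k"
  \<comment> \<open>The two derivatives fall one on each field, so |k| u is used for both
    factors.\<close>
  proof (rule fibre_summable_comparison[OF lam sq(1,1) k, of _ 2])
    fix p q
    have "norm (cdot (u p) (cvec q)) * norm (cross2 p (u q)) \<le> (norm (u p) * norm (cvec q)) * (2 * (norm p * norm (u q)))"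
      by (intro mult_mono norm_cdot_le norm_cross2_le) auto
    then show "norm (\<Psi>' (p, q)) \<le> 2 * (norm (norm p *\<^sub>R u p) * norm (norm q *\<^sub>R u q))"
      by (simp add: \<Psi>'_def norm_mult mult_ac)
  qed
  have \<Psi>'_zero: "infsum \<Psi>' (fibre lam k) = 0"
  proof (rule infsum_antisymmetric[where \<sigma> = prod.swap])
    fix x assume "x \<in> fibre lam k"
    then obtain p q where pq: "x = (p, q)" "p \<in> lat lam" "q \<in> lat lam" by auto
    then show "\<Psi>' (prod.swap x) = - \<Psi>' x"
      using cross2_exchange[OF Vm_cdot[OF u, of p] Vm_cdot[OF u, of q]]
      by (simp add: \<Psi>'_def add_eq_0_iff)
  qed (auto simp: add.commute)
  have eq: "\<Psi> x = ?S x + (- 1) * \<Psi>' x" if "x \<in> fibre lam k" for x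
    using that by (auto simp: \<Psi>_def \<Psi>'_def vort2_eq_cross2 cross2_def algebra_simps)
  have "\<Psi> summable_on fibre lam k \<longleftrightarrow> (\<lambda>x. ?S x + (- 1) * \<Psi>' x) summable_on fibre lam k"
    by (rule summable_on_cong[OF eq])
  then show "(\<lambda>(p, q). \<i> * cdot (u p) (cvec q) * vort2 u q) summable_on fibre lam k"
    unfolding \<Psi>_def[symmetric] by (simp only:) (intro summable_on_add S summable_on_cmult_right \<Psi>')
  have "infsum \<Psi> (fibre lam k) = infsum ?S (fibre lam k) + (\<Sum>\<^sub>\<infinity>x\<in>fibre lam k. (- 1) * \<Psi>' x)"
    using infsum_cong[of "fibre lam k" \<Psi>, OF eq] infsum_add[OF S summable_on_cmult_right[OF \<Psi>']]
    by (rule trans)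
  then show "(\<Sum>\<^sub>\<infinity>(p, q)\<in>fibre lam k. \<i> * cdot (u p) (cvec q) * vort2 u q) = vort2 (advect lam u) k"
    unfolding \<Psi>_def[symmetric] infsum_cmult_right[OF \<Psi>'] S_sum \<Psi>'_zero by simp
qed

text \<open>Taking the curl removes the pressure, leaving the vorticity transport equation tested
  with the vorticity. Its triad term is odd under the reflection, because u(p) . q changes sign
  while the two vorticity factors change places by the reality condition.\<close>

lemma infsum_enstrophy_balance:
  fixes u u' :: "real ^ 2 \<Rightarrow> complex ^ 2"
  assumes lam: "1 < lam" and m: "1 \<le> m" and u: "u \<in> Vm lam m" and u': "u' \<in> Vm lam m"
    and euler: "\<And>k i. k \<in> lat lam - {0} \<Longrightarrow>
        u' k $ i + advect lam u k $ i = - (\<i> * of_real (k $ i) * p k)"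
  shows "(\<Sum>\<^sub>\<infinity>k\<in>lat lam - {0}. vort2 u' k * cnj (vort2 u k)) = 0"
proof -
  note sq = Vm_square_summable[OF lam m u] and sq' = Vm_square_summable[OF lam m u']
  define \<Gamma> where "\<Gamma> = (\<lambda>(p, q). \<i> * cdot (u p) (cvec q) * vort2 u q * cnj (vort2 u (p + q)))"
  have vort_le: "norm (vort2 v k) \<le> 2 * (norm k * norm (v k))" for v and k :: "real ^ 2"
    using norm_cross2_le[of k "v k"] by (simp add: vort2_eq_cross2 norm_mult)
  have vort_uminus: "vort2 u (- k) = cnj (vort2 u k)" if "k \<in> lat lam" for k
    using Vm_uminus[OF u that] by (simp add: vort2_def algebra_simps)
  \<comment> \<open>At k = 0, where no equation is assumed, both sides vanish through the factor k
    in the curl.\<close>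
  have curl: "vort2 u' k = - vort2 (advect lam u) k" if k: "k \<in> lat lam" for k
  proof (cases "k = 0")
    case True
    then show ?thesis by (simp add: vort2_def)
  next
    case False
    then have "u' k $ i + advect lam u k $ i = - (\<i> * of_real (k $ i) * p k)" for i
      using euler k by blast
    then have "u' k $ i = - advect lam u k $ i - \<i> * of_real (k $ i) * p k" for i
      by (metis add_diff_cancel_right' diff_minus_eq_add minus_diff_commute add.commute uminus_add_conv_diff)
    then show ?thesis
      unfolding vort2_def by (simp only:) (simp add: algebra_simps)
  qed
  have fib: "\<Gamma> summable_on fibre lam k" "infsum \<Gamma> (fibre lam k) = - (vort2 u' k * cnj (vort2 u k))"
    if k: "k \<in> lat lam" for k
  proof -
    note A = infsum_curl_advect[OF lam m u k]
    have eq: "\<Gamma> x = (case x of (p, q) \<Rightarrow> \<i> * cdot (u p) (cvec q) * vort2 u q) * cnj (vort2 u k)"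
      if "x \<in> fibre lam k" for x
      using that by (auto simp: \<Gamma>_def)
    show "\<Gamma> summable_on fibre lam k"
      by (rule summable_on_cong[THEN iffD2, OF eq summable_on_cmult_left[OF A(1)]])
    show "infsum \<Gamma> (fibre lam k) = - (vort2 u' k * cnj (vort2 u k))"
      using trans[OF infsum_cong[of "fibre lam k" \<Gamma>, OF eq] infsum_cmult_left[OF A(1)]]
      by (simp add: A(2) curl[OF k])
  qed
  have zero: "(\<Sum>\<^sub>\<infinity>k\<in>lat lam. infsum \<Gamma> (fibre lam k)) = 0"
  proof (rule infsum_antisymmetric_triads[OF lam fib(1)])
    \<comment> \<open>Summability of the fibre sums is read off from the equation: u' lies in V^m
      too, so both vorticities are square summable.\<close>
    have "(\<lambda>k. - (vort2 u' k * cnj (vort2 u k))) summable_on lat lam"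
    proof (rule abs_summable_summable[OF Infinite_Sum.abs_summable_on_comparison_test'])
      show "(\<lambda>k. 4 * (norm (norm k *\<^sub>R u' k) * norm (norm k *\<^sub>R u k))) summable_on lat lam"
        by (intro summable_on_cmult_right Cauchy_Schwarz_infsum(1) sq(1) sq'(1))
      fix k :: "real ^ 2"
      have "norm (vort2 u' k) * norm (vort2 u k) \<le> (2 * (norm k * norm (u' k))) * (2 * (norm k * norm (u k)))"
        by (intro mult_mono vort_le) auto
      then show "norm (- (vort2 u' k * cnj (vort2 u k))) \<le> 4 * (norm (norm k *\<^sub>R u' k) * norm (norm k *\<^sub>R u k))"
        by (simp add: norm_mult mult_ac)
    qed
    then show "(\<lambda>k. infsum \<Gamma> (fibre lam k)) summable_on lat lam"
      by (rule summable_on_cong[THEN iffD1, rotated]) (simp add: fib(2))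
  next
    \<comment> \<open>The constant of \<open>triad_maxnorm_neq\<close> in the plane. It trades the
      |q| of the transport factor for C |p|, after which each field carries one derivative; the 4 in
      \<open>4 * C\<close> comes from the two vorticity bounds.\<close>
    define C where "C = real CARD(2) * (lam / (lam - 1))"
    show "\<Gamma> summable_on {(p, q) \<in> triads lam. maxnorm q \<noteq> maxnorm (p + q)}"
    proof (rule triads_summable_comparison[OF lam sq(1,1,1), of _ _ "4 * C"])
      fix p q :: "real ^ 2"
      assume "(p, q) \<in> {(p, q) \<in> triads lam. maxnorm q \<noteq> maxnorm (p + q)}"
      then have q: "norm q \<le> C * norm p"
        unfolding C_def by (intro triad_maxnorm_neq[OF lam]) auto
      have "norm (\<Gamma> (p, q)) = norm (cdot (u p) (cvec q)) * norm (vort2 u q) * norm (vort2 u (p + q))"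
        by (simp add: \<Gamma>_def norm_mult)
      also have "\<dots> \<le> (norm (u p) * norm (cvec q)) * (2 * (norm q * norm (u q))) * (2 * (norm (p + q) * norm (u (p + q))))"
        by (intro mult_mono norm_cdot_le vort_le) auto
      also have "\<dots> \<le> (norm (u p) * (C * norm p)) * (2 * (norm q * norm (u q))) * (2 * (norm (p + q) * norm (u (p + q))))"
        using q by (intro mult_right_mono mult_left_mono) auto
      finally show "norm (\<Gamma> (p, q)) \<le> 4 * C * (norm (norm p *\<^sub>R u p) * norm (norm q *\<^sub>R u q) * norm (norm (p + q) *\<^sub>R u (p + q)))"
        by (simp add: mult_ac)
    qed auto
  next
    fix a b :: "real ^ 2" assume ab: "(a, b) \<in> triads lam"
    have "cdot (u a) (cvec (- (a + b))) = - cdot (u a) (cvec b)"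
      using ab by (intro cdot_cvec_reflect Vm_cdot[OF u]) (simp add: triads_def)
    moreover have "vort2 u (- (a + b)) = cnj (vort2 u (a + b))" "vort2 u (- b) = cnj (vort2 u b)"
      using ab by (auto simp only: triads_def intro!: vort_uminus)
    ultimately show "\<Gamma> (a, - a - b) = - \<Gamma> (a, b)"
      by (simp add: \<Gamma>_def)
  qed
  have "(\<Sum>\<^sub>\<infinity>k\<in>lat lam - {0}. vort2 u' k * cnj (vort2 u k)) = (\<Sum>\<^sub>\<infinity>k\<in>lat lam. vort2 u' k * cnj (vort2 u k))"
    by (rule infsum_cong_neutral) (auto simp: vort2_def)
  also have "\<dots> = (\<Sum>\<^sub>\<infinity>k\<in>lat lam. - infsum \<Gamma> (fibre lam k))"
    by (rule infsum_cong) (simp add: fib(2))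
  also have "\<dots> = 0"
    unfolding infsum_uminus zero by simp
  finally show ?thesis .
qed

lemma enstrophy_constant:
  fixes u :: "real \<Rightarrow> real ^ 2 \<Rightarrow> complex ^ 2"
  assumes lam: "1 < lam" and m: "1 \<le> m" and sol: "strong_euler_solution lam m T u p"
    and st: "s \<in> {0..<T}" "t \<in> {0..<T}"
  shows "enstrophy lam (u s) = enstrophy lam (u t)"
proof -
  obtain u' where C1: "C1_Vm lam m T u u'"
    and euler: "\<And>t k i. t \<in> {0..<T} \<Longrightarrow> k \<in> lat lam - {0} \<Longrightarrow>
      u' t k $ i + advect lam (u t) k $ i = - (\<i> * of_real (k $ i) * p t k)"
    using sol unfolding strong_euler_solution_def by blast
  let ?b = "\<lambda>(k :: real ^ 2) x y. vort2 (\<lambda>_. x) k * cnj (vort2 (\<lambda>_. y) k)"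
  have bound: "norm (?b k x y) \<le> 4 * ((norm k)\<^sup>2 * (norm x * norm y))" for k x y
  proof -
    have "norm (?b k x y) \<le> (2 * (norm k * norm x)) * (2 * (norm k * norm y))"
      using mult_mono[OF norm_cross2_le[of k x] norm_cross2_le[of k y]] by (simp add: vort2_eq_cross2 norm_mult)
    then show ?thesis
      by (simp add: power2_eq_square mult_ac)
  qed
  have "(\<Sum>\<^sub>\<infinity>k\<in>lat lam - {0}. ?b k (u s k) (u s k)) = (\<Sum>\<^sub>\<infinity>k\<in>lat lam - {0}. ?b k (u t k) (u t k))"
  proof (rule hermitian_form_constant[where b = ?b and c = 4, OF lam m C1 _ _ _ _ _ st])
    fix k :: "real ^ 2"
    show "bounded_bilinear (?b k)"
    proof
      show "\<exists>K. \<forall>x y. norm (?b k x y) \<le> norm x * norm y * K"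
        using bound[of _ k] by (intro exI[of _ "4 * (norm k)\<^sup>2"]) (simp add: mult_ac)
    qed (simp_all add: vort2_def scaleR_conv_of_real[where 'a = complex] algebra_simps)
  next
    fix r assume r: "r \<in> {0..<T}"
    have "(\<Sum>\<^sub>\<infinity>k\<in>lat lam - {0}. vort2 (u' r) k * cnj (vort2 (u r) k)) = 0"
      using C1 r by (intro infsum_enstrophy_balance[OF lam m _ _ euler[OF r]]) (simp_all add: C1_Vm_def)
    then show "(\<Sum>\<^sub>\<infinity>k\<in>lat lam - {0}. ?b k (u' r k) (u r k)) = 0"
      by (simp add: vort2_def)
  qed (simp_all add: bound)
  moreover have "enstrophy lam v = (\<Sum>\<^sub>\<infinity>k\<in>lat lam - {0}. ?b k (v k) (v k)) / 2" for v
    unfolding enstrophy_def sinner_def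
    by (intro arg_cong[where f = "\<lambda>z. z / 2"] infsum_cong_neutral) (auto simp: vort2_def)
  ultimately show ?thesis by (simp only:)
qed

theorem theorem5:
  fixes lam :: real and m :: nat and T :: real
  assumes "admissible_lambda lam" and "1 \<le> m"
  shows "(\<forall>(u :: real \<Rightarrow> (real ^ 3) \<Rightarrow> complex ^ 3) p.
            strong_euler_solution lam m T u p \<longrightarrow>
            (\<forall>s\<in>{0..<T}. \<forall>t\<in>{0..<T}.
               energy lam (u s) = energy lam (u t) \<and> helicity lam (u s) = helicity lam (u t)))
       \<and> (\<forall>(u :: real \<Rightarrow> (real ^ 2) \<Rightarrow> complex ^ 2) p.
            strong_euler_solution lam m T u p \<longrightarrow>
            (\<forall>s\<in>{0..<T}. \<forall>t\<in>{0..<T}.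
               energy lam (u s) = energy lam (u t) \<and> enstrophy lam (u s) = enstrophy lam (u t)))"
  by (intro conjI allI impI ballI; rule energy_constant helicity_constant enstrophy_constant;
      (assumption | rule admissible_lambda_gt_1[OF assms(1)] assms(2)))

end
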